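(* Let $(\Omega,\Sigma)$ be a measurable space. Every $B(\Omega)$-module $L_p(\Omega,\mu)$, with $p\in[1,+\infty]$ and $\mu\in M(\Omega)$, is relatively injective, metrically injective and extremely injective in the category $\mathscr{L}$.
   Context: All linear spaces are over $\mathbb{C}$. $B(\Omega)$ is the Banach algebra of bounded measurable functions on $(\Omega,\Sigma)$ with the sup-norm. $M(\Omega)$ is the space of finite complex-valued $\sigma$-additive measures on $(\Omega,\Sigma)$; for complex $\mu$, $L_p(\Omega,\mu)$ is understood as $L_p(\Omega,|\mu|)$. Each $L_p(\Omega,\mu)$ is a left Banach $B(\Omega)$-module under pointwise multiplication $b\cdot f$. $\mathscr{L}$ is the full subcategory of the category of left Banach $B(\Omega)$-modules (morphisms: bounded $B(\Omega)$-module maps) whose objects are the modules $L_p(\Omega,\mu)$, $p\in[1,+\infty]$, $\mu\in M(\Omega)$. $\mathscr{L}_1$ has the same objects but only contractive morphisms (norm $\leq1$). $\operatorname{Hom}_{\mathscr{L}}(X,Y)$ carries the operator norm. For an operator $T:X\to Y$ between normed spaces: $T$ is topologically injective if $\|T(x)\|\geq c\|x\|$ for some $c>0$ and all $x$; isometric if $\|T(x)\|=\|x\|$ for all $x$; coisometric if it is contractive and for every $c'>1$ and $y\in Y$ there is $x$ with $T(x)=y$ and $\|x\|<c'\|y\|$ (for $y=0$ take $x=0$); strictly coisometric if it is contractive and for every $y\in Y$ there is $x$ with $T(x)=y$ and $\|x\|\leq\|y\|$. A morphism is a relatively / metrically / extremely admissible monomorphism if it is topologically injective / isometric / isometric, respectively.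 An object $I$ of $\mathscr{L}$ is relatively / metrically / extremely injective in $\mathscr{L}$ if for every relatively / metrically / extremely admissible monomorphism $i:X\to Y$ in $\mathscr{L}$ / $\mathscr{L}_1$ / $\mathscr{L}_1$, the operator $\operatorname{Hom}_{\mathscr{L}}(i,I):\operatorname{Hom}_{\mathscr{L}}(Y,I)\to\operatorname{Hom}_{\mathscr{L}}(X,I)$, $\psi\mapsto\psi i$, is surjective / strictly coisometric / coisometric, respectively. *)

theory Defs
  imports "HOL-Probability.Essential_Supremum"
begin

section \<open>Normed spaces and normed modules with explicit carriers\<close>

record 'x nspace =
  pts :: "'x set"
  nzero :: "'x"
  nadd :: "'x \<Rightarrow> 'x \<Rightarrow> 'x"
  nscale :: "complex \<Rightarrow> 'x \<Rightarrow> 'x"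
  nnorm :: "'x \<Rightarrow> real"

record ('b, 'x) nmodule = "'x nspace" +
  act :: "'b \<Rightarrow> 'x \<Rightarrow> 'x"

definition bounded_map :: "('x, 'm) nspace_scheme \<Rightarrow> ('y, 'n) nspace_scheme \<Rightarrow> ('x \<Rightarrow> 'y) \<Rightarrow> bool" where
  "bounded_map X Y T \<longleftrightarrow> (\<exists>C. \<forall>x\<in>pts X. nnorm Y (T x) \<le> C * nnorm X x)"

text \<open>The supremum is taken in the reals, so it is the operator norm for bounded maps only.\<close>

definition op_norm :: "('x, 'm) nspace_scheme \<Rightarrow> ('y, 'n) nspace_scheme \<Rightarrow> ('x \<Rightarrow> 'y) \<Rightarrow> real" where
  "op_norm X Y T = (SUP x\<in>{x \<in> pts X. nnorm X x \<le> 1}. nnorm Y (T x))"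

definition contractive :: "('x, 'm) nspace_scheme \<Rightarrow> ('y, 'n) nspace_scheme \<Rightarrow> ('x \<Rightarrow> 'y) \<Rightarrow> bool" where
  "contractive X Y T \<longleftrightarrow> bounded_map X Y T \<and> op_norm X Y T \<le> 1"

definition topologically_injective ::
    "('x, 'm) nspace_scheme \<Rightarrow> ('y, 'n) nspace_scheme \<Rightarrow> ('x \<Rightarrow> 'y) \<Rightarrow> bool" where
  "topologically_injective X Y T \<longleftrightarrow> (\<exists>c>0. \<forall>x\<in>pts X. nnorm Y (T x) \<ge> c * nnorm X x)"

definition isometric :: "('x, 'm) nspace_scheme \<Rightarrow> ('y, 'n) nspace_scheme \<Rightarrow> ('x \<Rightarrow> 'y) \<Rightarrow> bool" where
  "isometric X Y T \<longleftrightarrow> (\<forall>x\<in>pts X. nnorm Y (T x) = nnorm X x)"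

definition surjective :: "('x, 'm) nspace_scheme \<Rightarrow> ('y, 'n) nspace_scheme \<Rightarrow> ('x \<Rightarrow> 'y) \<Rightarrow> bool" where
  "surjective X Y T \<longleftrightarrow> (\<forall>y\<in>pts Y. \<exists>x\<in>pts X. T x = y)"

text \<open>The strict inequality cannot hold for the zero vector, whose preimage is required to be zero.\<close>

definition coisometric :: "('x, 'm) nspace_scheme \<Rightarrow> ('y, 'n) nspace_scheme \<Rightarrow> ('x \<Rightarrow> 'y) \<Rightarrow> bool" where
  "coisometric X Y T \<longleftrightarrow> contractive X Y T \<and>
     (\<forall>c>1. \<forall>y\<in>pts Y. \<exists>x\<in>pts X. T x = y \<and>
        (if y = nzero Y then x = nzero X else nnorm X x < c * nnorm Y y))"

definition strictly_coisometric ::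
    "('x, 'm) nspace_scheme \<Rightarrow> ('y, 'n) nspace_scheme \<Rightarrow> ('x \<Rightarrow> 'y) \<Rightarrow> bool" where
  "strictly_coisometric X Y T \<longleftrightarrow> contractive X Y T \<and>
     (\<forall>y\<in>pts Y. \<exists>x\<in>pts X. T x = y \<and> nnorm X x \<le> nnorm Y y)"

text \<open>Maps are extensional, so that equality of maps on the carrier is equality in HOL.\<close>

definition module_maps ::
    "'b set \<Rightarrow> ('b, 'x, 'm) nmodule_scheme \<Rightarrow> ('b, 'y, 'n) nmodule_scheme \<Rightarrow> ('x \<Rightarrow> 'y) set" where
  "module_maps B X Y = {T \<in> pts X \<rightarrow>\<^sub>E pts Y.
     (\<forall>x\<in>pts X. \<forall>y\<in>pts X. T (nadd X x y) = nadd Y (T x) (T y)) \<and>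
     (\<forall>c. \<forall>x\<in>pts X. T (nscale X c x) = nscale Y c (T x)) \<and>
     (\<forall>b\<in>B. \<forall>x\<in>pts X. T (act X b x) = act Y b (T x)) \<and>
     bounded_map X Y T}"

definition Hom ::
    "'b set \<Rightarrow> ('b, 'x, 'm) nmodule_scheme \<Rightarrow> ('b, 'y, 'n) nmodule_scheme \<Rightarrow> ('x \<Rightarrow> 'y) nspace" where
  "Hom B X Y = \<lparr>
     pts = module_maps B X Y,
     nzero = (\<lambda>x\<in>pts X. nzero Y),
     nadd = (\<lambda>S T. \<lambda>x\<in>pts X. nadd Y (S x) (T x)),
     nscale = (\<lambda>c T. \<lambda>x\<in>pts X. nscale Y c (T x)),
     nnorm = op_norm X Y\<rparr>"

text \<open>The operator \<open>Hom(i, I)\<close> for \<open>i : X \<rightarrow> Y\<close>; it does not depend on \<open>Y\<close> and \<open>I\<close> as a map.\<close>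

definition Hom_pre :: "('x, 'm) nspace_scheme \<Rightarrow> ('x \<Rightarrow> 'y) \<Rightarrow> ('y \<Rightarrow> 'z) \<Rightarrow> ('x \<Rightarrow> 'z)" where
  "Hom_pre X i = (\<lambda>\<psi>. compose (pts X) \<psi> i)"


section \<open>Complex measures and total variation\<close>

text \<open>Taking all \<open>A i\<close> empty forces \<open>\<mu> {} = 0\<close>. Values of \<open>\<mu>\<close> outside \<open>\<A>\<close> are irrelevant.\<close>

definition complex_measure :: "'a set set \<Rightarrow> ('a set \<Rightarrow> complex) \<Rightarrow> bool" where
  "complex_measure \<A> \<mu> \<longleftrightarrow>
     (\<forall>A :: nat \<Rightarrow> 'a set. range A \<subseteq> \<A> \<longrightarrow> disjoint_family A \<longrightarrow> (\<lambda>i. \<mu> (A i)) sums \<mu> (\<Union>i. A i))"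

definition countable_partitions :: "'a set set \<Rightarrow> 'a set \<Rightarrow> (nat \<Rightarrow> 'a set) set" where
  "countable_partitions \<A> E = {A. range A \<subseteq> \<A> \<and> disjoint_family A \<and> (\<Union>i. A i) = E}"

definition total_variation :: "'a set set \<Rightarrow> ('a set \<Rightarrow> complex) \<Rightarrow> 'a set \<Rightarrow> ennreal" where
  "total_variation \<A> \<mu> E = (SUP A\<in>countable_partitions \<A> E. \<Sum>i. ennreal (norm (\<mu> (A i))))"

definition variation_measure :: "'a set \<Rightarrow> 'a set set \<Rightarrow> ('a set \<Rightarrow> complex) \<Rightarrow> 'a measure" where
  "variation_measure \<Omega> \<A> \<mu> = measure_of \<Omega> \<A> (total_variation \<A> \<mu>)"

lemma complex_measure_empty:
  assumes "complex_measure \<A> \<mu>" "{} \<in> \<A>"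
  shows "\<mu> {} = 0"
proof -
  have "(\<lambda>i::nat. \<mu> {}) sums \<mu> (\<Union>i::nat. {})"
    using assms(2) assms(1)[unfolded complex_measure_def, rule_format, of "\<lambda>_. {}"]
    by (simp add: disjoint_family_on_def image_subset_iff)
  then have "(\<lambda>i::nat. \<mu> {}) \<longlonglongrightarrow> 0"
    using sums_summable summable_LIMSEQ_zero by blast
  then show ?thesis by (simp add: LIMSEQ_const_iff)
qed

lemma trivial_partition:
  assumes "sigma_algebra \<Omega> \<A>" "E \<in> \<A>"
  shows "(\<lambda>i::nat. if i = 0 then E else {}) \<in> countable_partitions \<A> E"
proof -
  interpret sigma_algebra \<Omega> \<A> by fact
  show ?thesis using assms(2)
    by (auto simp: countable_partitions_def disjoint_family_on_def split: if_splits)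
qed

lemma total_variation_superadd:
  assumes "sigma_algebra \<Omega> \<A>" "complex_measure \<A> \<mu>" "E \<in> \<A>" "F \<in> \<A>" "E \<inter> F = {}"
  shows "total_variation \<A> \<mu> E + total_variation \<A> \<mu> F \<le> total_variation \<A> \<mu> (E \<union> F)"
proof -
  interpret sigma_algebra \<Omega> \<A> by fact
  let ?v = "\<lambda>A::nat \<Rightarrow> 'a set. \<Sum>i. ennreal (norm (\<mu> (A i)))"
  have ne: "countable_partitions \<A> E \<noteq> {}" "countable_partitions \<A> F \<noteq> {}"
    using trivial_partition assms by blast+
  have mu0: "\<mu> {} = 0" using complex_measure_empty assms(2) by blast
  have *: "?v A + ?v B \<le> total_variation \<A> \<mu> (E \<union> F)"
    if A: "A \<in> countable_partitions \<A> E" and B: "B \<in> countable_partitions \<A> F" for A B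
  proof -
    define D where "D = (\<lambda>(k::nat, i). if k = 0 then A i else if k = 1 then B i else {})"
    define C where "C = (\<lambda>i. D (prod_decode i))"
    have AE: "\<And>i. A i \<subseteq> E" "\<And>i. B i \<subseteq> F" using A B by (auto simp: countable_partitions_def)
    have dA: "A i \<inter> A j = {}" "B i \<inter> B j = {}" if "i \<noteq> j" for i j
      using that A B unfolding countable_partitions_def disjoint_family_on_def by blast+
    have AB: "A i \<inter> B j = {}" "B j \<inter> A i = {}" for i j using AE assms(5) by blast+
    have DD: "D p \<inter> D q = {}" if "p \<noteq> q" for p q
      using that by (cases p; cases q) (auto simp: D_def dA AB)
    have "disjoint_family C"
      unfolding disjoint_family_on_def C_def using DD inj_prod_decode by (metis injD)
    moreover have "range C \<subseteq> \<A>"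
      using A B
      by (auto simp: C_def D_def countable_partitions_def image_subset_iff split: prod.splits)
    moreover have "(\<Union>i. C i) = E \<union> F"
    proof -
      have "range C = D ` range prod_decode" by (auto simp: C_def)
      then have "(\<Union>i. C i) = (\<Union>p. D p)" by (simp add: surj_prod_decode)
      also have "\<dots> = (\<Union>i. A i) \<union> (\<Union>i. B i)"
      proof (intro set_eqI iffI)
        fix x assume "x \<in> (\<Union>p. D p)"
        then show "x \<in> (\<Union>i. A i) \<union> (\<Union>i. B i)" by (auto simp: D_def split: if_splits)
      next
        fix x assume "x \<in> (\<Union>i. A i) \<union> (\<Union>i. B i)"
        then obtain i where "x \<in> D (0, i) \<or> x \<in> D (1, i)" by (auto simp: D_def)
        then show "x \<in> (\<Union>p. D p)" by blast
      qed
      finally show ?thesis using A B by (auto simp: countable_partitions_def)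
    qed
    ultimately have C: "C \<in> countable_partitions \<A> (E \<union> F)"
      by (simp add: countable_partitions_def)
    have "?v C = (\<Sum>k. \<Sum>i. ennreal (norm (\<mu> (D (k, i)))))"
      unfolding C_def
      using suminf_ennreal_2dimen[where f = "\<lambda>p. ennreal (norm (\<mu> (D p)))", OF refl] by simp
    also have "\<dots> = (\<Sum>k\<in>{0,1}. \<Sum>i. ennreal (norm (\<mu> (D (k, i)))))"
      by (rule suminf_finite) (auto simp: D_def mu0)
    also have "\<dots> = ?v A + ?v B" by (simp add: D_def)
    finally show ?thesis unfolding total_variation_def using C by (metis SUP_upper)
  qed
  have "total_variation \<A> \<mu> E + total_variation \<A> \<mu> F
      = (SUP B\<in>countable_partitions \<A> F. SUP A\<in>countable_partitions \<A> E. ?v A + ?v B)"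
    using ne by (simp add: total_variation_def ennreal_SUP_add_left ennreal_SUP_add_right)
  also have "\<dots> \<le> total_variation \<A> \<mu> (E \<union> F)"
    using * by (intro SUP_least) auto
  finally show ?thesis .
qed

lemma total_variation_mono:
  assumes "sigma_algebra \<Omega> \<A>" "complex_measure \<A> \<mu>" "E \<in> \<A>" "F \<in> \<A>" "E \<subseteq> F"
  shows "total_variation \<A> \<mu> E \<le> total_variation \<A> \<mu> F"
proof -
  interpret sigma_algebra \<Omega> \<A> by fact
  have "total_variation \<A> \<mu> E + total_variation \<A> \<mu> (F - E) \<le> total_variation \<A> \<mu> (E \<union> (F - E))"
    by (rule total_variation_superadd[OF assms(1,2)]) (use assms in auto)
  moreover have "E \<union> (F - E) = F" using assms(5) by blast
  ultimately show ?thesis by (metis le_iff_add order_trans)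
qed

lemma suminf_ennreal_swap:
  fixes f :: "nat \<Rightarrow> nat \<Rightarrow> ennreal"
  shows "(\<Sum>i. \<Sum>j. f i j) = (\<Sum>j. \<Sum>i. f i j)"
proof -
  have "(\<Sum>i. \<Sum>j. f i j) = (\<integral>\<^sup>+i. (\<Sum>j. f i j) \<partial>count_space UNIV)"
    by (simp add: nn_integral_count_space_nat)
  also have "\<dots> = (\<Sum>j. \<integral>\<^sup>+i. f i j \<partial>count_space UNIV)"
    by (rule nn_integral_suminf) simp
  finally show ?thesis by (simp add: nn_integral_count_space_nat)
qed

lemma total_variation_measure_space:
  assumes "sigma_algebra \<Omega> \<A>" "complex_measure \<A> \<mu>"
  shows "measure_space \<Omega> \<A> (total_variation \<A> \<mu>)"
proof -
  interpret sigma_algebra \<Omega> \<A> by fact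
  let ?tv = "total_variation \<A> \<mu>"
  have mu0: "\<mu> {} = 0" using complex_measure_empty assms(2) by blast
  have "positive \<A> ?tv"
  proof -
    have "(\<Sum>i. ennreal (norm (\<mu> (A i)))) = 0" if "A \<in> countable_partitions \<A> {}" for A
    proof -
      have "A = (\<lambda>_. {})" using that by (auto simp: countable_partitions_def)
      then show ?thesis by (simp add: mu0)
    qed
    then have "?tv {} \<le> 0"
      unfolding total_variation_def by (intro SUP_least eq_refl)
    then show ?thesis by (simp add: positive_def)
  qed
  moreover have "countably_additive \<A> ?tv"
  proof (rule countably_additiveI)
    fix E :: "nat \<Rightarrow> 'a set"
    assume E: "range E \<subseteq> \<A>" "disjoint_family E" "(\<Union>i. E i) \<in> \<A>"
    have disj: "E i \<inter> E j = {}" if "i \<noteq> j" for i j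
      using E(2) that by (simp add: disjoint_family_on_def)
    have E_in: "E i \<in> \<A>" for i using E(1) by (simp add: image_subset_iff)
    show "(\<Sum>i. ?tv (E i)) = ?tv (\<Union>i. E i)"
    proof (rule antisym)
      have part: "(\<Sum>i<n. ?tv (E i)) \<le> ?tv (\<Union>i<n. E i)" for n
      proof (induction n)
        case (Suc n)
        have "(\<Union>i<n. E i) \<inter> E n = {}"
        proof -
          have "E i \<inter> E n = {}" if "i < n" for i using disj that by simp
          then show ?thesis by blast
        qed
        moreover have "(\<Union>i<n. E i) \<in> \<A>" "E n \<in> \<A>"
          using E_in by (simp_all add: finite_UN)
        ultimately have "?tv (\<Union>i<n. E i) + ?tv (E n) \<le> ?tv ((\<Union>i<n. E i) \<union> E n)"
          by (intro total_variation_superadd[OF assms])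
        moreover have "(\<Union>i<n. E i) \<union> E n = (\<Union>i<Suc n. E i)"
          by (auto simp: lessThan_Suc)
        moreover have "(\<Sum>i<Suc n. ?tv (E i)) \<le> ?tv (\<Union>i<n. E i) + ?tv (E n)"
          unfolding sum.lessThan_Suc using Suc by (rule add_right_mono)
        ultimately show ?case by (metis order_trans)
      qed simp
      have "(\<Sum>i<n. ?tv (E i)) \<le> ?tv (\<Union>i. E i)" for n
      proof -
        have "(\<Union>i<n. E i) \<in> \<A>" using E_in by (simp add: finite_UN)
        then have "?tv (\<Union>i<n. E i) \<le> ?tv (\<Union>i. E i)"
          by (rule total_variation_mono[OF assms _ E(3)]) blast
        with part show ?thesis by (rule order_trans)
      qed
      then show "(\<Sum>i. ?tv (E i)) \<le> ?tv (\<Union>i. E i)"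
        by (intro suminf_le_const) auto
    next
      show "?tv (\<Union>i. E i) \<le> (\<Sum>i. ?tv (E i))"
        unfolding total_variation_def[of \<A> \<mu> "\<Union>i. E i"]
      proof (rule SUP_least)
        fix B assume B: "B \<in> countable_partitions \<A> (\<Union>i. E i)"
        have B': "range B \<subseteq> \<A>" "disjoint_family B" "(\<Union>j. B j) = (\<Union>i. E i)"
          using B by (simp_all add: countable_partitions_def)
        have mem: "B j \<inter> E i \<in> \<A>" for i j
          using B'(1) E_in by (simp add: image_subset_iff Int)
        have "ennreal (norm (\<mu> (B j))) \<le> (\<Sum>i. ennreal (norm (\<mu> (B j \<inter> E i))))" for j
        proof (cases "summable (\<lambda>i. norm (\<mu> (B j \<inter> E i)))")
          case True
          have "(\<Union>i. B j \<inter> E i) = B j" using B'(3) by blast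
          moreover have "disjoint_family (\<lambda>i. B j \<inter> E i)"
            unfolding disjoint_family_on_def using disj by blast
          moreover have "range (\<lambda>i. B j \<inter> E i) \<subseteq> \<A>" using mem by (simp add: image_subset_iff)
          ultimately have "(\<lambda>i. \<mu> (B j \<inter> E i)) sums \<mu> (B j)"
            using assms(2)[unfolded complex_measure_def, rule_format, of "\<lambda>i. B j \<inter> E i"] by simp
          then have "norm (\<mu> (B j)) \<le> (\<Sum>i. norm (\<mu> (B j \<inter> E i)))"
            using summable_norm[OF True] by (simp add: sums_iff)
          then show ?thesis using True by (simp add: suminf_ennreal2 ennreal_leI)
        next
          case False
          then have "(\<Sum>i. ennreal (norm (\<mu> (B j \<inter> E i)))) = top"
            using summable_suminf_not_top[of "\<lambda>i. norm (\<mu> (B j \<inter> E i))", OF norm_ge_zero] by argo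
          then show ?thesis by (simp only: top_greatest)
        qed
        then have "(\<Sum>j. ennreal (norm (\<mu> (B j)))) \<le> (\<Sum>j. \<Sum>i. ennreal (norm (\<mu> (B j \<inter> E i))))"
          by (rule suminf_le[OF _ summableI summableI])
        also have "\<dots> = (\<Sum>i. \<Sum>j. ennreal (norm (\<mu> (B j \<inter> E i))))"
          by (rule suminf_ennreal_swap)
        also have "\<dots> \<le> (\<Sum>i. ?tv (E i))"
        proof (rule suminf_le[OF _ summableI summableI])
          fix i
          have "disjoint_family (\<lambda>j. B j \<inter> E i)"
            using B'(2) unfolding disjoint_family_on_def by blast
          moreover have "(\<Union>j. B j \<inter> E i) = E i" using B'(3) by blast
          ultimately have "(\<lambda>j. B j \<inter> E i) \<in> countable_partitions \<A> (E i)"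
            using mem by (simp add: countable_partitions_def image_subset_iff)
          then show "(\<Sum>j. ennreal (norm (\<mu> (B j \<inter> E i)))) \<le> ?tv (E i)"
            unfolding total_variation_def by (rule SUP_upper)
        qed
        finally show "(\<Sum>j. ennreal (norm (\<mu> (B j)))) \<le> (\<Sum>i. ?tv (E i))" .
      qed
    qed
  qed
  ultimately show ?thesis by (simp add: measure_space_def sigma_algebra_axioms)
qed

lemma
  assumes "sigma_algebra \<Omega> \<A>"
  shows space_variation_measure: "space (variation_measure \<Omega> \<A> \<mu>) = \<Omega>"
    and sets_variation_measure: "sets (variation_measure \<Omega> \<A> \<mu>) = \<A>"
proof -
  interpret sigma_algebra \<Omega> \<A> by fact
  show "space (variation_measure \<Omega> \<A> \<mu>) = \<Omega>" "sets (variation_measure \<Omega> \<A> \<mu>) = \<A>"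
    by (simp_all add: variation_measure_def space_closed)
qed

lemma emeasure_variation_measure:
  assumes "sigma_algebra \<Omega> \<A>" "complex_measure \<A> \<mu>" "E \<in> \<A>"
  shows "emeasure (variation_measure \<Omega> \<A> \<mu>) E = total_variation \<A> \<mu> E"
proof -
  interpret sigma_algebra \<Omega> \<A> by fact
  show ?thesis
    using total_variation_measure_space[OF assms(1,2)] assms(3)
    by (intro emeasure_measure_of[OF variation_measure_def])
       (auto simp: measure_space_def space_closed sets_variation_measure[OF assms(1)])
qed


section \<open>The spaces \<open>L\<^sub>p\<close>\<close>

definition Lp_funs :: "'a measure \<Rightarrow> ennreal \<Rightarrow> ('a \<Rightarrow> complex) set" where
  "Lp_funs M p = {f \<in> borel_measurable M.
     if p = \<infinity> then esssup M (\<lambda>x. ennreal (norm (f x))) < \<infinity>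
     else integrable M (\<lambda>x. norm (f x) powr enn2real p)}"

definition Lp_seminorm :: "'a measure \<Rightarrow> ennreal \<Rightarrow> ('a \<Rightarrow> complex) \<Rightarrow> real" where
  "Lp_seminorm M p f =
     (if p = \<infinity> then enn2real (esssup M (\<lambda>x. ennreal (norm (f x))))
      else (\<integral>x. norm (f x) powr enn2real p \<partial>M) powr (1 / enn2real p))"

definition ae_class :: "'a measure \<Rightarrow> ('a \<Rightarrow> complex) \<Rightarrow> ('a \<Rightarrow> complex) set" where
  "ae_class M f = {g \<in> borel_measurable M. AE x in M. g x = f x}"

text \<open>Points are almost-everywhere equality classes. The operations are given on representatives,
  and each union is a union of equal classes. Values of functions outside \<open>space M\<close> are ignored
  by \<open>ae_class\<close>.\<close>

definition Lp_of :: "'a measure \<Rightarrow> ennreal \<Rightarrow> ('a \<Rightarrow> complex, ('a \<Rightarrow> complex) set) nmodule" where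
  "Lp_of M p = \<lparr>
     pts = ae_class M ` Lp_funs M p,
     nzero = ae_class M (\<lambda>x. 0),
     nadd = (\<lambda>F G. \<Union>f\<in>F. \<Union>g\<in>G. ae_class M (\<lambda>x. f x + g x)),
     nscale = (\<lambda>c F. \<Union>f\<in>F. ae_class M (\<lambda>x. c * f x)),
     nnorm = (\<lambda>F. the_elem (Lp_seminorm M p ` F)),
     act = (\<lambda>b F. \<Union>f\<in>F. ae_class M (\<lambda>x. b x * f x))\<rparr>"

definition Lp :: "'a set \<Rightarrow> 'a set set \<Rightarrow> ('a set \<Rightarrow> complex) \<Rightarrow> ennreal
    \<Rightarrow> ('a \<Rightarrow> complex, ('a \<Rightarrow> complex) set) nmodule" where
  "Lp \<Omega> \<A> \<mu> p = Lp_of (variation_measure \<Omega> \<A> \<mu>) p"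

lemma ae_class_self: "f \<in> borel_measurable M \<Longrightarrow> f \<in> ae_class M f"
  by (simp add: ae_class_def)

lemma ae_class_cong:
  assumes "AE x in M. f x = g x"
  shows "ae_class M f = ae_class M g"
proof -
  have "(AE x in M. h x = f x) \<longleftrightarrow> (AE x in M. h x = g x)" for h
    using assms by (intro eventually_subst) (auto elim: eventually_mono)
  then show ?thesis by (simp add: ae_class_def)
qed

lemma Lp_seminorm_cong:
  assumes "f \<in> borel_measurable M" "g \<in> borel_measurable M" "AE x in M. f x = g x"
  shows "Lp_seminorm M p f = Lp_seminorm M p g"
proof -
  have "esssup M (\<lambda>x. ennreal (norm (f x))) = esssup M (\<lambda>x. ennreal (norm (g x)))"
    using assms by (intro esssup_AE_cong) (auto intro: borel_measurable_norm measurable_compose)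
  moreover have "(\<integral>x. norm (f x) powr enn2real p \<partial>M) = (\<integral>x. norm (g x) powr enn2real p \<partial>M)"
    using assms by (intro integral_cong_AE) auto
  ultimately show ?thesis by (simp add: Lp_seminorm_def)
qed

lemma
  assumes f: "f \<in> borel_measurable M"
  shows Lp_nadd_class: "g \<in> borel_measurable M \<Longrightarrow>
      nadd (Lp_of M p) (ae_class M f) (ae_class M g) = ae_class M (\<lambda>x. f x + g x)"
    and Lp_nscale_class: "nscale (Lp_of M p) c (ae_class M f) = ae_class M (\<lambda>x. c * f x)"
    and Lp_act_class: "act (Lp_of M p) b (ae_class M f) = ae_class M (\<lambda>x. b x * f x)"
    and Lp_nnorm_class: "nnorm (Lp_of M p) (ae_class M f) = Lp_seminorm M p f"
proof -
  have UN_const: "(\<Union>x\<in>F. h x) = C" if "a \<in> F" "\<And>x. x \<in> F \<Longrightarrow> h x = C"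
    for F :: "('a \<Rightarrow> complex) set" and h :: "('a \<Rightarrow> complex) \<Rightarrow> ('a \<Rightarrow> complex) set" and C a
    using that by blast
  have 1: "ae_class M (\<lambda>x. f' x + g' x) = ae_class M (\<lambda>x. f x + g x)"
    if "f' \<in> ae_class M f" "g' \<in> ae_class M g" for f' g'
  proof (rule ae_class_cong)
    have "AE x in M. f' x = f x" "AE x in M. g' x = g x" using that by (auto simp: ae_class_def)
    then show "AE x in M. f' x + g' x = f x + g x" by eventually_elim simp
  qed
  show "nadd (Lp_of M p) (ae_class M f) (ae_class M g) = ae_class M (\<lambda>x. f x + g x)"
    if g: "g \<in> borel_measurable M"
    unfolding Lp_of_def nspace.simps
    by (rule UN_const[OF ae_class_self[OF f]], rule UN_const[OF ae_class_self[OF g]], rule 1)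
  have 2: "ae_class M (\<lambda>x. b x * f' x) = ae_class M (\<lambda>x. b x * f x)"
    if "f' \<in> ae_class M f" for f' b
  proof (rule ae_class_cong)
    have "AE x in M. f' x = f x" using that by (auto simp: ae_class_def)
    then show "AE x in M. b x * f' x = b x * f x" by eventually_elim simp
  qed
  show "act (Lp_of M p) b (ae_class M f) = ae_class M (\<lambda>x. b x * f x)"
    unfolding Lp_of_def nmodule.simps by (rule UN_const[OF ae_class_self[OF f]], rule 2)
  show "nscale (Lp_of M p) c (ae_class M f) = ae_class M (\<lambda>x. c * f x)"
    unfolding Lp_of_def nspace.simps by (rule UN_const[OF ae_class_self[OF f]], rule 2)
  have "Lp_seminorm M p ` ae_class M f = {Lp_seminorm M p f}"
  proof (intro set_eqI iffI; clarsimp)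
    fix g assume "g \<in> ae_class M f"
    then show "Lp_seminorm M p g = Lp_seminorm M p f"
      by (intro Lp_seminorm_cong) (auto simp: ae_class_def f)
  next
    show "Lp_seminorm M p f \<in> Lp_seminorm M p ` ae_class M f"
      using ae_class_self[OF f] by (rule imageI)
  qed
  then show "nnorm (Lp_of M p) (ae_class M f) = Lp_seminorm M p f"
    by (simp add: Lp_of_def)
qed


section \<open>The category \<open>\<L>\<close> and injectivity\<close>

text \<open>Only the values of a function on \<open>\<Omega>\<close> matter, both here and for the action on \<open>Lp\<close>.\<close>

definition bounded_measurable :: "'a set \<Rightarrow> 'a set set \<Rightarrow> ('a \<Rightarrow> complex) set" where
  "bounded_measurable \<Omega> \<A> = {b \<in> borel_measurable (sigma \<Omega> \<A>). bounded (b ` \<Omega>)}"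

definition L_obj :: "'a set \<Rightarrow> 'a set set \<Rightarrow> ('a \<Rightarrow> complex, ('a \<Rightarrow> complex) set) nmodule set" where
  "L_obj \<Omega> \<A> = {Lp \<Omega> \<A> \<mu> p | \<mu> p. complex_measure \<A> \<mu> \<and> 1 \<le> p}"

abbreviation L_Hom where
  "L_Hom \<Omega> \<A> X Y \<equiv> Hom (bounded_measurable \<Omega> \<A>) X Y"

definition L_mor :: "'a set \<Rightarrow> 'a set set \<Rightarrow> ('a \<Rightarrow> complex, 'x, 'm) nmodule_scheme
    \<Rightarrow> ('a \<Rightarrow> complex, 'y, 'n) nmodule_scheme \<Rightarrow> ('x \<Rightarrow> 'y) set" where
  "L_mor \<Omega> \<A> X Y = module_maps (bounded_measurable \<Omega> \<A>) X Y"

definition L1_mor :: "'a set \<Rightarrow> 'a set set \<Rightarrow> ('a \<Rightarrow> complex, 'x, 'm) nmodule_scheme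
    \<Rightarrow> ('a \<Rightarrow> complex, 'y, 'n) nmodule_scheme \<Rightarrow> ('x \<Rightarrow> 'y) set" where
  "L1_mor \<Omega> \<A> X Y = {i \<in> L_mor \<Omega> \<A> X Y. contractive X Y i}"

definition relatively_injective where
  "relatively_injective \<Omega> \<A> I \<longleftrightarrow> I \<in> L_obj \<Omega> \<A> \<and>
     (\<forall>X\<in>L_obj \<Omega> \<A>. \<forall>Y\<in>L_obj \<Omega> \<A>. \<forall>i\<in>L_mor \<Omega> \<A> X Y. topologically_injective X Y i \<longrightarrow>
        surjective (L_Hom \<Omega> \<A> Y I) (L_Hom \<Omega> \<A> X I) (Hom_pre X i))"

definition metrically_injective where
  "metrically_injective \<Omega> \<A> I \<longleftrightarrow> I \<in> L_obj \<Omega> \<A> \<and>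
     (\<forall>X\<in>L_obj \<Omega> \<A>. \<forall>Y\<in>L_obj \<Omega> \<A>. \<forall>i\<in>L1_mor \<Omega> \<A> X Y. isometric X Y i \<longrightarrow>
        strictly_coisometric (L_Hom \<Omega> \<A> Y I) (L_Hom \<Omega> \<A> X I) (Hom_pre X i))"

definition extremely_injective where
  "extremely_injective \<Omega> \<A> I \<longleftrightarrow> I \<in> L_obj \<Omega> \<A> \<and>
     (\<forall>X\<in>L_obj \<Omega> \<A>. \<forall>Y\<in>L_obj \<Omega> \<A>. \<forall>i\<in>L1_mor \<Omega> \<A> X Y. isometric X Y i \<longrightarrow>
        coisometric (L_Hom \<Omega> \<A> Y I) (L_Hom \<Omega> \<A> X I) (Hom_pre X i))"

end

theory Submission
  imports Defs
begin

text \<open>The reason for the theorem is that every topologically injective module map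
  \<open>i : L\<^sub>p(M) \<rightarrow> L\<^sub>q(N)\<close> has a left inverse \<open>j\<close> that is again a module map, so that a map \<open>T\<close> on
  \<open>L\<^sub>p(M)\<close> with values in any module extends along \<open>i\<close> to \<open>T \<circ> j\<close>.

  The left inverse is explicit. As the measures are finite, \<open>L\<^sub>p(M)\<close> contains the constant function
  \<open>1\<close>; put \<open>g = i(1)\<close>. Linearity over bounded functions gives \<open>i(f) = f g\<close>, first for bounded \<open>f\<close>
  and then, by truncation, for all \<open>f\<close>. Injectivity of \<open>i\<close> makes \<open>M\<close> absolutely
  continuous with respect to \<open>N\<close> and makes \<open>g\<close> nonzero \<open>M\<close>-almost everywhere. Hence
  \<open>j(h) = h / g\<close>, read as \<open>0\<close> where \<open>g\<close> vanishes, is well defined on classes and inverts \<open>i\<close> from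
  the left. That \<open>h / g\<close> is in \<open>L\<^sub>p(M)\<close> at all is the lower bound \<open>c \<parallel>f\<parallel> \<le> \<parallel>f g\<parallel>\<close> applied to the
  bounded truncations of \<open>h / g\<close>, whose products with \<open>g\<close> are dominated by \<open>h\<close>; monotone
  convergence then gives \<open>\<parallel>j(h)\<parallel> \<le> \<parallel>h\<parallel> / c\<close>. This is \<open>topologically_injective_has_retraction\<close>.

  If \<open>i\<close> is isometric, then \<open>c = 1\<close>, so \<open>j\<close> is contractive and the extension \<open>T \<circ> j\<close> has norm at most
  the norm of \<open>T\<close>: this is metric injectivity, and extreme injectivity follows because the operator norm
  separates points. The one measure-theoretic ingredient of substance is that a complex measure has finite total variation
  (\<open>total_variation_finite\<close>), without which \<open>1\<close> need not be in \<open>L\<^sub>p\<close>.\<close>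


section \<open>Finiteness of the total variation\<close>

text \<open>Split the numbers according to the sign of the real part and again according to the sign of the
  imaginary part. Within each of the four families one coordinate does not cancel, and the four sums
  together bound the sum of the norms; the largest of them does the job.\<close>

lemma sum_norm_le_4_norm_subset_sum:
  fixes z :: "'i \<Rightarrow> complex"
  assumes "finite J"
  shows "\<exists>S\<subseteq>J. (\<Sum>i\<in>J. norm (z i)) \<le> 4 * norm (\<Sum>i\<in>S. z i)"
proof (rule ccontr)
  assume neg: "\<not> ?thesis"
  let ?s = "\<lambda>P. \<Sum>i\<in>{i\<in>J. P i}. z i"
  have small: "4 * norm (?s P) < (\<Sum>i\<in>J. norm (z i))" for P
    using neg by (force simp: not_le)
  have split: "(\<Sum>i\<in>J. \<bar>f (z i)\<bar>) \<le> norm (?s (\<lambda>i. 0 \<le> f (z i))) + norm (?s (\<lambda>i. \<not> 0 \<le> f (z i)))"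
    if f: "f = Re \<or> f = Im" for f
  proof -
    have fs: "f (sum z S) = (\<Sum>i\<in>S. f (z i))" for S using f by auto
    have fn: "\<bar>f w\<bar> \<le> norm w" for w using f abs_Re_le_cmod abs_Im_le_cmod by auto
    have "(\<Sum>i\<in>J. \<bar>f (z i)\<bar>)
        = (\<Sum>i\<in>{i\<in>J. 0 \<le> f (z i)}. \<bar>f (z i)\<bar>) + (\<Sum>i\<in>{i\<in>J. \<not> 0 \<le> f (z i)}. \<bar>f (z i)\<bar>)"
      using assms by (subst sum.union_disjoint[symmetric]) (auto intro!: sum.cong)
    also have "\<dots> = f (?s (\<lambda>i. 0 \<le> f (z i))) - f (?s (\<lambda>i. \<not> 0 \<le> f (z i)))"
      by (simp add: fs sum_negf[symmetric])
    also have "\<dots> \<le> norm (?s (\<lambda>i. 0 \<le> f (z i))) + norm (?s (\<lambda>i. \<not> 0 \<le> f (z i)))"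
      using fn[of "?s (\<lambda>i. 0 \<le> f (z i))"] fn[of "?s (\<lambda>i. \<not> 0 \<le> f (z i))"] by linarith
    finally show ?thesis .
  qed
  have "(\<Sum>i\<in>J. norm (z i)) \<le> (\<Sum>i\<in>J. \<bar>Re (z i)\<bar>) + (\<Sum>i\<in>J. \<bar>Im (z i)\<bar>)"
    by (simp add: sum.distrib[symmetric] sum_mono cmod_le)
  then show False
    using split[of Re] split[of Im] small[of "\<lambda>i. 0 \<le> Re (z i)"] small[of "\<lambda>i. \<not> 0 \<le> Re (z i)"]
      small[of "\<lambda>i. 0 \<le> Im (z i)"] small[of "\<lambda>i. \<not> 0 \<le> Im (z i)"]
    by simp
qed

lemma complex_measure_Un:
  assumes "sigma_algebra \<Omega> \<A>" "complex_measure \<A> \<mu>" "E \<in> \<A>" "F \<in> \<A>" "E \<inter> F = {}"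
  shows "\<mu> (E \<union> F) = \<mu> E + \<mu> F"
proof -
  interpret sigma_algebra \<Omega> \<A> by fact
  have "(\<lambda>n. \<mu> (binaryset E F n)) sums \<mu> (\<Union>n. binaryset E F n)"
    using assms by (intro assms(2)[unfolded complex_measure_def, rule_format])
      (auto simp: range_binaryset_eq disjoint_family_on_def binaryset_def)
  moreover have "(\<lambda>n. \<mu> (binaryset E F n)) sums (\<mu> E + \<mu> F)"
    by (rule binaryset_sums) (use complex_measure_empty assms(2) in blast)
  ultimately show ?thesis
    using sums_unique2 UN_binaryset_eq by metis
qed

lemma complex_measure_UN:
  assumes "sigma_algebra \<Omega> \<A>" "complex_measure \<A> \<mu>" "finite S"
    and "\<And>i. i \<in> S \<Longrightarrow> A i \<in> \<A>" "disjoint_family_on A S"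
  shows "\<mu> (\<Union>i\<in>S. A i) = (\<Sum>i\<in>S. \<mu> (A i))"
  using assms(3-5)
proof (induction S)
  case empty
  interpret sigma_algebra \<Omega> \<A> by fact
  show ?case using complex_measure_empty assms(2) by fastforce
next
  case (insert i S)
  interpret sigma_algebra \<Omega> \<A> by fact
  have "disjoint_family_on A S" "A i \<inter> (\<Union>j\<in>S. A j) = {}"
    using insert.prems(2) insert.hyps(2) by (auto simp: disjoint_family_on_def)
  then show ?case
    using insert complex_measure_Un[OF assms(1,2), of "A i" "\<Union>j\<in>S. A j"]
    by (auto simp: finite_UN)
qed

text \<open>A set \<open>E\<close> of infinite variation has a subset \<open>D\<close> whose measure exceeds \<open>1 + \<bar>\<mu>(E)\<bar>\<close>, a union of
  pieces of a partition whose measures have a large sum of norms. Then both \<open>D\<close> and \<open>E - D\<close> have measure larger than \<open>1\<close>, and by additivity of the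
  variation one of them is again of infinite variation.\<close>

lemma infinite_variation_split:
  assumes "sigma_algebra \<Omega> \<A>" "complex_measure \<A> \<mu>" "E \<in> \<A>" "total_variation \<A> \<mu> E = \<infinity>"
  shows "\<exists>F\<in>\<A>. F \<subseteq> E \<and> norm (\<mu> (E - F)) > 1 \<and> total_variation \<A> \<mu> F = \<infinity>"
proof -
  interpret sigma_algebra \<Omega> \<A> by fact
  \<comment> \<open>The factor 4 pays for passing from the sum of norms to the norm of a partial sum.\<close>
  define t where "t = 4 * (1 + norm (\<mu> E))"
  have "0 \<le> t" by (simp add: t_def)
  have "ennreal t < total_variation \<A> \<mu> E" using assms(4) by simp
  then obtain A where A: "A \<in> countable_partitions \<A> E"
    and "ennreal t < (\<Sum>i. ennreal (norm (\<mu> (A i))))"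
    unfolding total_variation_def by (auto simp: less_SUP_iff)
  then obtain n where "ennreal t < (\<Sum>i<n. ennreal (norm (\<mu> (A i))))"
    by (auto simp: suminf_eq_SUP less_SUP_iff)
  then have t: "t < (\<Sum>i<n. norm (\<mu> (A i)))"
    using \<open>0 \<le> t\<close> by (simp add: ennreal_less_iff)
  obtain S where S: "S \<subseteq> {..<n}" "(\<Sum>i<n. norm (\<mu> (A i))) \<le> 4 * norm (\<Sum>i\<in>S. \<mu> (A i))"
    using sum_norm_le_4_norm_subset_sum[of "{..<n}" "\<lambda>i. \<mu> (A i)"] by auto
  define D where "D = (\<Union>i\<in>S. A i)"
  have AA: "A i \<in> \<A>" "A i \<subseteq> E" for i
    using A by (auto simp: countable_partitions_def)
  have fS: "finite S" using S(1) finite_subset by blast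
  have "disjoint_family_on A S"
    using A by (auto simp: countable_partitions_def disjoint_family_on_def)
  then have "\<mu> D = (\<Sum>i\<in>S. \<mu> (A i))"
    unfolding D_def using complex_measure_UN[OF assms(1,2) fS] AA by blast
  then have D_big: "norm (\<mu> D) > 1 + norm (\<mu> E)"
    using S(2) t by (simp add: t_def)
  have D: "D \<in> \<A>" "D \<subseteq> E" using AA fS by (auto simp: D_def)
  have ED: "E - D \<in> \<A>" "D \<union> (E - D) = E" using D assms(3) by auto
  have "\<mu> E = \<mu> D + \<mu> (E - D)"
    using complex_measure_Un[OF assms(1,2) D(1) ED(1)] ED(2) by simp
  then have ED_big: "norm (\<mu> (E - D)) > 1"
    using D_big norm_triangle_ineq4[of "\<mu> E" "\<mu> (E - D)"] by simp
  let ?V = "variation_measure \<Omega> \<A> \<mu>"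
  have "emeasure ?V D + emeasure ?V (E - D) = emeasure ?V E"
    using plus_emeasure[of D ?V "E - D"] D ED by (simp add: sets_variation_measure[OF assms(1)])
  then have "total_variation \<A> \<mu> D + total_variation \<A> \<mu> (E - D) = \<infinity>"
    using assms(3,4) D ED by (simp add: emeasure_variation_measure[OF assms(1,2)])
  then consider "total_variation \<A> \<mu> D = \<infinity>" | "total_variation \<A> \<mu> (E - D) = \<infinity>"
    by (auto simp: ennreal_add_eq_top)
  then show ?thesis
  proof cases
    case 1
    then show ?thesis using D ED_big by blast
  next
    case 2
    have "E - (E - D) = D" using D by blast
    moreover have "norm (\<mu> D) > 1" using D_big norm_ge_zero[of "\<mu> E"] by linarith
    ultimately show ?thesis using 2 ED(1) by (intro bexI[of _ "E - D"]) auto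
  qed
qed

text \<open>Otherwise, repeated splitting produces infinitely many disjoint sets of measure larger than \<open>1\<close>
  in absolute value, and the series of their measures cannot converge.\<close>

lemma total_variation_finite:
  assumes "sigma_algebra \<Omega> \<A>" "complex_measure \<A> \<mu>"
  shows "total_variation \<A> \<mu> \<Omega> \<noteq> \<infinity>"
proof
  interpret sigma_algebra \<Omega> \<A> by fact
  assume inf: "total_variation \<A> \<mu> \<Omega> = \<infinity>"
  obtain E :: "nat \<Rightarrow> 'a set" where
    E: "E n \<in> \<A> \<and> total_variation \<A> \<mu> (E n) = \<infinity>"
    and step: "E (Suc n) \<subseteq> E n \<and> norm (\<mu> (E n - E (Suc n))) > 1" for n
  proof (rule dependent_nat_choice[where
        P = "\<lambda>_ F. F \<in> \<A> \<and> total_variation \<A> \<mu> F = \<infinity>"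
        and Q = "\<lambda>_ F G. G \<subseteq> F \<and> norm (\<mu> (F - G)) > 1", THEN exE])
    show "\<exists>F. F \<in> \<A> \<and> total_variation \<A> \<mu> F = \<infinity>" using inf by blast
    show "\<exists>G. (G \<in> \<A> \<and> total_variation \<A> \<mu> G = \<infinity>) \<and> G \<subseteq> F \<and> norm (\<mu> (F - G)) > 1"
      if "F \<in> \<A> \<and> total_variation \<A> \<mu> F = \<infinity>" for F :: "'a set" and n :: nat
      using infinite_variation_split[OF assms] that by metis
  qed auto
  have "antimono E" using step by (simp add: antimono_iff_le_Suc)
  have "(E m - E (Suc m)) \<inter> (E n - E (Suc n)) = {}" if "m < n" for m n
    using antimonoD[OF \<open>antimono E\<close>, of "Suc m" n] that by auto
  then have "disjoint_family (\<lambda>n. E n - E (Suc n))"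
    unfolding disjoint_family_on_def by (metis Int_commute linorder_neqE_nat)
  then have "(\<lambda>n. \<mu> (E n - E (Suc n))) sums \<mu> (\<Union>n. E n - E (Suc n))"
    using E by (intro assms(2)[unfolded complex_measure_def, rule_format]) auto
  then have "(\<lambda>n. \<mu> (E n - E (Suc n))) \<longlonglongrightarrow> 0"
    using sums_summable summable_LIMSEQ_zero by blast
  then obtain n where "norm (\<mu> (E n - E (Suc n))) < 1"
    using LIMSEQ_D[of _ 0 1] by fastforce
  then show False using step[of n] by simp
qed

lemma finite_measure_variation:
  assumes "sigma_algebra \<Omega> \<A>" "complex_measure \<A> \<mu>"
  shows "finite_measure (variation_measure \<Omega> \<A> \<mu>)"
proof
  interpret sigma_algebra \<Omega> \<A> by fact
  show "emeasure (variation_measure \<Omega> \<A> \<mu>) (space (variation_measure \<Omega> \<A> \<mu>)) \<noteq> \<infinity>"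
    using total_variation_finite[OF assms] emeasure_variation_measure[OF assms top]
    by (simp add: space_variation_measure[OF assms(1)])
qed

section \<open>Functions in \<open>L\<^sub>p\<close>\<close>

lemma Lp_funs_measurable: "f \<in> Lp_funs M p \<Longrightarrow> f \<in> borel_measurable M"
  by (simp add: Lp_funs_def)

lemma enn2real_ge_1: "1 \<le> p \<Longrightarrow> p \<noteq> \<infinity> \<Longrightarrow> 1 \<le> enn2real p"
  by (cases p) auto

lemma Lp_seminorm_nonneg: "0 \<le> Lp_seminorm M p f"
  by (simp add: Lp_seminorm_def)

text \<open>Membership of bounded functions, closure under the module operations, invariance under
  almost everywhere equality and the estimates for the norms are all instances of domination.\<close>

lemma Lp_dominated:
  assumes p: "1 \<le> p" and g: "g \<in> Lp_funs M p" and f: "f \<in> borel_measurable M"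
    and C: "0 \<le> C" and le: "AE x in M. norm (f x) \<le> C * norm (g x)"
  shows "f \<in> Lp_funs M p" "Lp_seminorm M p f \<le> C * Lp_seminorm M p g"
proof -
  note [measurable] = f Lp_funs_measurable[OF g]
  have "f \<in> Lp_funs M p \<and> Lp_seminorm M p f \<le> C * Lp_seminorm M p g"
  proof (cases "p = \<infinity>")
    case True
    let ?N = "\<lambda>h. esssup M (\<lambda>x. ennreal (norm (h x :: complex)))"
    have fin: "?N g < \<infinity>" using g True by (simp add: Lp_funs_def)
    have "AE x in M. ennreal (norm (f x)) \<le> ennreal C * ?N g"
      using le esssup_AE[of "\<lambda>x. ennreal (norm (g x))" M]
    proof eventually_elim
      case (elim x)
      have "ennreal (norm (f x)) \<le> ennreal C * ennreal (norm (g x))"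
        using elim(1) C by (simp add: ennreal_mult[symmetric])
      also have "\<dots> \<le> ennreal C * ?N g" using elim(2) by (rule mult_left_mono) simp
      finally show ?case .
    qed
    then have *: "?N f \<le> ennreal C * ?N g" by (intro esssup_I) auto
    have fin': "ennreal C * ?N g < \<infinity>" using fin by (simp add: ennreal_mult_less_top)
    have "enn2real (?N f) \<le> enn2real (ennreal C * ?N g)"
      using * fin' by (intro enn2real_mono) auto
    then show ?thesis
      using True le_less_trans[OF * fin'] f C by (simp add: Lp_funs_def Lp_seminorm_def enn2real_mult)
  next
    case False
    define r where "r = enn2real p"
    have r: "1 \<le> r" using enn2real_ge_1[OF p False] by (simp add: r_def)
    have ig: "integrable M (\<lambda>x. norm (g x) powr r)"
      using g False by (simp add: Lp_funs_def r_def)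
    have le': "AE x in M. norm (f x) powr r \<le> C powr r * norm (g x) powr r"
      using le by eventually_elim (use r C in \<open>simp add: powr_mult[symmetric] powr_mono2\<close>)
    have "integrable M (\<lambda>x. norm (f x) powr r)"
      by (rule Bochner_Integration.integrable_bound[OF integrable_mult_right[OF ig, of "C powr r"]])
        (use le' in auto)
    then have if': "f \<in> Lp_funs M p" using f False by (simp add: Lp_funs_def r_def)
    have "(\<integral>x. norm (f x) powr r \<partial>M) \<le> (\<integral>x. C powr r * norm (g x) powr r \<partial>M)"
      using le' ig \<open>integrable M (\<lambda>x. norm (f x) powr r)\<close> by (intro integral_mono_AE) auto
    then have "(\<integral>x. norm (f x) powr r \<partial>M) powr (1 / r)
        \<le> (C powr r * (\<integral>x. norm (g x) powr r \<partial>M)) powr (1 / r)"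
      using r by (intro powr_mono2) auto
    also have "\<dots> = C * (\<integral>x. norm (g x) powr r \<partial>M) powr (1 / r)"
      using r C by (simp add: powr_mult powr_powr)
    finally show ?thesis using if' False by (simp add: Lp_seminorm_def r_def)
  qed
  then show "f \<in> Lp_funs M p" "Lp_seminorm M p f \<le> C * Lp_seminorm M p g" by auto
qed

lemma bounded_in_Lp_funs:
  assumes "finite_measure M" "1 \<le> p" "f \<in> borel_measurable M"
    and "\<And>x. x \<in> space M \<Longrightarrow> norm (f x) \<le> C"
  shows "f \<in> Lp_funs M p"
proof (rule Lp_dominated[OF assms(2) _ assms(3), of "\<lambda>_. 1" "\<bar>C\<bar>"])
  interpret finite_measure M by fact
  have "esssup M (\<lambda>x. 1::ennreal) \<le> 1" by (rule esssup_I) auto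
  then have "esssup M (\<lambda>x. 1::ennreal) < \<infinity>" by (rule le_less_trans) simp
  then show "(\<lambda>_. 1) \<in> Lp_funs M p" by (auto simp: Lp_funs_def)
  show "AE x in M. norm (f x) \<le> \<bar>C\<bar> * norm (1 :: complex)"
    using assms(4) by (intro AE_I2) force
qed auto

lemma Lp_funs_add:
  assumes "1 \<le> p" "f \<in> Lp_funs M p" "g \<in> Lp_funs M p"
  shows "(\<lambda>x. f x + g x) \<in> Lp_funs M p"
  \<comment> \<open>The sum is dominated by twice the pointwise maximum, which stays in \<open>L\<^sub>p\<close>; thus
    membership needs no Minkowski inequality.\<close>
proof (rule Lp_dominated[OF assms(1), of "\<lambda>x. complex_of_real (max (norm (f x)) (norm (g x)))" _ _ 2])
  note [measurable] = Lp_funs_measurable[OF assms(2)] Lp_funs_measurable[OF assms(3)]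
  show "(\<lambda>x. f x + g x) \<in> borel_measurable M" by measurable
  have n: "norm (f x + g x) \<le> 2 * norm (complex_of_real (max (norm (f x)) (norm (g x))))" for x
    using norm_triangle_ineq[of "f x" "g x"] by (simp add: max_def)
  then show "AE x in M. norm (f x + g x) \<le> 2 * norm (complex_of_real (max (norm (f x)) (norm (g x))))"
    by simp
  show "(\<lambda>x. complex_of_real (max (norm (f x)) (norm (g x)))) \<in> Lp_funs M p"
  proof (cases "p = \<infinity>")
    case True
    let ?N = "\<lambda>h. esssup M (\<lambda>x. ennreal (norm (h x :: complex)))"
    have "?N (\<lambda>x. complex_of_real (max (norm (f x)) (norm (g x)))) \<le> max (?N f) (?N g)"
    proof (rule esssup_I)
      show "AE x in M. ennreal (norm (complex_of_real (max (norm (f x)) (norm (g x))))) \<le> max (?N f) (?N g)"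
        using esssup_AE[of "\<lambda>x. ennreal (norm (f x))" M] esssup_AE[of "\<lambda>x. ennreal (norm (g x))" M]
        by eventually_elim (auto simp: max_def)
    qed simp
    moreover have "max (?N f) (?N g) < \<infinity>"
      using assms(2,3) True by (simp add: Lp_funs_def max_def)
    ultimately have "?N (\<lambda>x. complex_of_real (max (norm (f x)) (norm (g x)))) < \<infinity>"
      by (rule le_less_trans)
    then show ?thesis using True by (simp add: Lp_funs_def)
  next
    case False
    let ?r = "enn2real p"
    have "integrable M (\<lambda>x. norm (f x) powr ?r + norm (g x) powr ?r)"
      using assms(2,3) False by (auto simp: Lp_funs_def)
    then have "integrable M (\<lambda>x. norm (complex_of_real (max (norm (f x)) (norm (g x)))) powr ?r)"
      by (rule Bochner_Integration.integrable_bound) (auto simp: max_def)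
    then show ?thesis using False by (simp add: Lp_funs_def)
  qed
qed auto

lemma Lp_seminorm_eq_0D:
  assumes "1 \<le> p" "f \<in> Lp_funs M p" "Lp_seminorm M p f \<le> 0"
  shows "AE x in M. f x = 0"
proof (cases "p = \<infinity>")
  case True
  have "enn2real (esssup M (\<lambda>x. ennreal (norm (f x)))) = 0"
    using assms(3) True by (simp add: Lp_seminorm_def antisym)
  then have "esssup M (\<lambda>x. ennreal (norm (f x))) = 0"
    using assms(2) True by (auto simp: Lp_funs_def enn2real_eq_0_iff)
  then show ?thesis
    using esssup_AE[of "\<lambda>x. ennreal (norm (f x))" M] by simp
next
  case False
  define r where "r = enn2real p"
  have "integrable M (\<lambda>x. norm (f x) powr r)"
    using assms(2) False by (simp add: Lp_funs_def r_def)
  moreover have "(\<integral>x. norm (f x) powr r \<partial>M) = 0"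
    using assms(3) False by (simp add: Lp_seminorm_def r_def)
  ultimately have "AE x in M. norm (f x) powr r = 0"
    by (subst (asm) integral_nonneg_eq_0_iff_AE) auto
  then show ?thesis by simp
qed

text \<open>This is a monotone convergence theorem that covers \<open>p = \<infinity>\<close> as well. It is what shows that the quotient
  \<open>h / g\<close> of the retraction is an \<open>L\<^sub>p\<close> function.\<close>

lemma Lp_truncation_bound:
  fixes f :: "'a \<Rightarrow> complex"
  defines "t \<equiv> \<lambda>n::nat. \<lambda>x. if norm (f x) \<le> real n then f x else 0"
  assumes p: "1 \<le> p" and f[measurable]: "f \<in> borel_measurable M"
    and t: "\<And>n. t n \<in> Lp_funs M p" "\<And>n. Lp_seminorm M p (t n) \<le> K"
  shows "f \<in> Lp_funs M p" "Lp_seminorm M p f \<le> K"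
proof -
  have [measurable]: "t n \<in> borel_measurable M" for n using t(1) by (rule Lp_funs_measurable)
  have K: "0 \<le> K" using t(2)[of 0] Lp_seminorm_nonneg[of M p] order_trans by blast
  have "f \<in> Lp_funs M p \<and> Lp_seminorm M p f \<le> K"
  proof (cases "p = \<infinity>")
    case True
    let ?N = "\<lambda>h. esssup M (\<lambda>x. ennreal (norm (h x :: complex)))"
    have N: "?N (t n) \<le> ennreal K" for n
    proof -
      have "?N (t n) < \<infinity>" "enn2real (?N (t n)) \<le> K"
        using t[of n] True by (simp_all add: Lp_funs_def Lp_seminorm_def)
      then show ?thesis using ennreal_leI[of "enn2real (?N (t n))" K] by (simp add: less_top)
    qed
    have "AE x in M. ennreal (norm (t n x)) \<le> ennreal K" for n
      using esssup_AE[of "\<lambda>x. ennreal (norm (t n x))" M] by (rule eventually_mono) (rule order_trans[OF _ N])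
    then have "AE x in M. \<forall>n. ennreal (norm (t n x)) \<le> ennreal K" by (simp add: AE_all_countable)
    then have "AE x in M. ennreal (norm (f x)) \<le> ennreal K"
    proof eventually_elim
      case (elim x)
      \<comment> \<open>From some index on, the truncation at \<open>x\<close> is the function itself.\<close>
      have "t (nat \<lceil>norm (f x)\<rceil>) x = f x" by (simp add: t_def)
      then show ?case using elim by metis
    qed
    then have *: "?N f \<le> ennreal K" by (intro esssup_I) auto
    then have "?N f < \<infinity>" by (rule le_less_trans) simp
    moreover have "enn2real (?N f) \<le> K" using enn2real_mono[OF *] K by simp
    ultimately show ?thesis using True by (simp add: Lp_funs_def Lp_seminorm_def)
  next
    case False
    define r where "r = enn2real p"
    have r: "1 \<le> r" using enn2real_ge_1[OF p False] by (simp add: r_def)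
    let ?F = "\<lambda>n x. ennreal (norm (t n x) powr r)"
    have I: "(\<integral>\<^sup>+x. ?F n x \<partial>M) \<le> ennreal (K powr r)" for n
    proof -
      have int: "integrable M (\<lambda>x. norm (t n x) powr r)"
        using t(1)[of n] False by (simp add: Lp_funs_def r_def)
      have "(\<integral>x. norm (t n x) powr r \<partial>M) = Lp_seminorm M p (t n) powr r"
        using False r by (simp add: Lp_seminorm_def r_def[symmetric] powr_powr)
      also have "\<dots> \<le> K powr r" using t(2)[of n] r by (intro powr_mono2) (auto simp: Lp_seminorm_nonneg)
      finally show ?thesis using int by (simp add: nn_integral_eq_integral)
    qed
    have "incseq ?F"
    proof (intro incseq_SucI le_funI ennreal_leI)
      show "norm (t n x) powr r \<le> norm (t (Suc n) x) powr r" for n x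
        using r by (intro powr_mono2) (auto simp: t_def)
    qed
    moreover have "(SUP n. ?F n x) = ennreal (norm (f x) powr r)" for x
    proof (rule antisym)
      show "(SUP n. ?F n x) \<le> ennreal (norm (f x) powr r)"
        by (intro SUP_least ennreal_leI) (auto simp: t_def)
      have "t (nat \<lceil>norm (f x)\<rceil>) x = f x" by (simp add: t_def)
      then show "ennreal (norm (f x) powr r) \<le> (SUP n. ?F n x)"
        using SUP_upper[of "nat \<lceil>norm (f x)\<rceil>" UNIV "\<lambda>n. ?F n x"] by simp
    qed
    ultimately have "(\<integral>\<^sup>+x. ennreal (norm (f x) powr r) \<partial>M) = (SUP n. \<integral>\<^sup>+x. ?F n x \<partial>M)"
      using nn_integral_monotone_convergence_SUP[of ?F M] by simp
    also have "\<dots> \<le> ennreal (K powr r)" by (rule SUP_least) (rule I)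
    finally have nn: "(\<integral>\<^sup>+x. ennreal (norm (f x) powr r) \<partial>M) \<le> ennreal (K powr r)" .
    have int: "integrable M (\<lambda>x. norm (f x) powr r)"
      using nn by (intro integrableI_bounded) (auto intro: le_less_trans)
    have "(\<integral>x. norm (f x) powr r \<partial>M) \<le> K powr r"
      using nn int by (simp add: nn_integral_eq_integral)
    then have "(\<integral>x. norm (f x) powr r \<partial>M) powr (1 / r) \<le> (K powr r) powr (1 / r)"
      using r by (intro powr_mono2) auto
    then show ?thesis using int False r K by (simp add: Lp_funs_def Lp_seminorm_def r_def[symmetric] powr_powr)
  qed
  then show "f \<in> Lp_funs M p" "Lp_seminorm M p f \<le> K" by auto
qed


section \<open>Points of \<open>L\<^sub>p\<close>\<close>

lemma ae_class_eqD:
  assumes "ae_class M f = ae_class M g" "f \<in> borel_measurable M"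
  shows "AE x in M. f x = g x"
  using ae_class_self[OF assms(2)] assms(1) by (auto simp: ae_class_def)

lemma Lp_ptsI: "f \<in> Lp_funs M p \<Longrightarrow> ae_class M f \<in> pts (Lp_of M p)"
  by (simp add: Lp_of_def)

lemma Lp_pts_iff:
  assumes "1 \<le> p" "f \<in> borel_measurable M"
  shows "ae_class M f \<in> pts (Lp_of M p) \<longleftrightarrow> f \<in> Lp_funs M p"
proof
  assume "ae_class M f \<in> pts (Lp_of M p)"
  then obtain g where g: "g \<in> Lp_funs M p" "ae_class M f = ae_class M g"
    by (auto simp: Lp_of_def)
  have "AE x in M. norm (f x) \<le> 1 * norm (g x)"
    using ae_class_eqD[OF g(2) assms(2)] by eventually_elim simp
  then show "f \<in> Lp_funs M p" by (rule Lp_dominated(1)[OF assms(1) g(1) assms(2) zero_le_one])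
qed (simp add: Lp_of_def)

lemma Lp_ptsE:
  assumes "x \<in> pts (Lp_of M p)"
  obtains f where "f \<in> Lp_funs M p" "f \<in> borel_measurable M" "x = ae_class M f"
  using assms Lp_funs_measurable by (auto simp: Lp_of_def)

lemma Lp_nzero: "nzero (Lp_of M p) = ae_class M (\<lambda>x. 0)"
  by (simp add: Lp_of_def)

lemma Lp_nzero_pts: "1 \<le> p \<Longrightarrow> nzero (Lp_of M p) \<in> pts (Lp_of M p)"
  using esssup_I[of "\<lambda>_. 0" M "0::ennreal"] by (simp add: Lp_nzero Lp_pts_iff Lp_funs_def)

lemma Lp_nadd_pts:
  assumes "1 \<le> p" "x \<in> pts (Lp_of M p)" "y \<in> pts (Lp_of M p)"
  shows "nadd (Lp_of M p) x y \<in> pts (Lp_of M p)"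
  using assms by (auto elim!: Lp_ptsE simp: Lp_nadd_class Lp_pts_iff Lp_funs_add)

lemma Lp_act_pts:
  assumes "1 \<le> p" "x \<in> pts (Lp_of M p)" "b \<in> borel_measurable M" "bounded (b ` space M)"
  shows "act (Lp_of M p) b x \<in> pts (Lp_of M p)"
proof -
  obtain f where f: "f \<in> Lp_funs M p" "f \<in> borel_measurable M" "x = ae_class M f"
    using assms(2) by (rule Lp_ptsE)
  obtain C where C: "\<And>t. t \<in> space M \<Longrightarrow> norm (b t) \<le> C"
    using assms(4) by (auto simp: bounded_iff)
  have "AE t in M. norm (b t * f t) \<le> \<bar>C\<bar> * norm (f t)"
    using C by (intro AE_I2) (force simp: norm_mult intro: mult_right_mono)
  then have "(\<lambda>t. b t * f t) \<in> Lp_funs M p"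
    using assms f by (intro Lp_dominated(1)[OF assms(1) f(1)]) auto
  then show ?thesis using f assms by (simp add: Lp_act_class Lp_pts_iff)
qed

lemma Lp_nscale_pts:
  assumes "1 \<le> p" "x \<in> pts (Lp_of M p)"
  shows "nscale (Lp_of M p) c x \<in> pts (Lp_of M p)"
proof -
  obtain f where f: "f \<in> Lp_funs M p" "f \<in> borel_measurable M" "x = ae_class M f"
    using assms(2) by (rule Lp_ptsE)
  show ?thesis
    using Lp_act_pts[OF assms, of "\<lambda>_. c"] f by (simp add: Lp_act_class Lp_nscale_class image_constant_conv)
qed

lemma Lp_nscale_norm_le:
  assumes "1 \<le> p" "x \<in> pts (Lp_of M p)"
  shows "nnorm (Lp_of M p) (nscale (Lp_of M p) c x) \<le> norm c * nnorm (Lp_of M p) x"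
proof -
  obtain f where f: "f \<in> Lp_funs M p" "f \<in> borel_measurable M" "x = ae_class M f"
    using assms(2) by (rule Lp_ptsE)
  have "Lp_seminorm M p (\<lambda>t. c * f t) \<le> norm c * Lp_seminorm M p f"
    using f by (intro Lp_dominated(2)[OF assms(1) f(1)]) (auto simp: norm_mult)
  then show ?thesis using f by (simp add: Lp_nscale_class Lp_nnorm_class)
qed

lemma Lp_nscale_nscale:
  assumes "x \<in> pts (Lp_of M p)"
  shows "nscale (Lp_of M p) c (nscale (Lp_of M p) d x) = nscale (Lp_of M p) (c * d) x"
    "nscale (Lp_of M p) 1 x = x"
  using assms by (auto elim!: Lp_ptsE simp: Lp_nscale_class mult.assoc)

lemma Lp_nnorm_nonneg: "x \<in> pts (Lp_of M p) \<Longrightarrow> 0 \<le> nnorm (Lp_of M p) x"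
  by (auto elim!: Lp_ptsE simp: Lp_nnorm_class Lp_seminorm_nonneg)

lemma Lp_nnorm_eq_0D:
  assumes "1 \<le> p" "x \<in> pts (Lp_of M p)" "nnorm (Lp_of M p) x \<le> 0"
  shows "x = nzero (Lp_of M p)"
  using assms Lp_seminorm_eq_0D
  by (auto elim!: Lp_ptsE simp: Lp_nnorm_class Lp_nzero intro!: ae_class_cong)

lemma Lp_nnorm_nzero: "1 \<le> p \<Longrightarrow> nnorm (Lp_of M p) (nzero (Lp_of M p)) = 0"
proof -
  have "Lp_seminorm M p (\<lambda>x. 0) \<le> 0" if "1 \<le> p"
    using Lp_dominated(2)[OF that, of "\<lambda>x. 0" M "\<lambda>x. 0" 0] that Lp_nzero_pts[OF that, of M]
    by (simp add: Lp_nzero Lp_pts_iff)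
  then show "1 \<le> p \<Longrightarrow> nnorm (Lp_of M p) (nzero (Lp_of M p)) = 0"
    using Lp_seminorm_nonneg[of M p "\<lambda>x. 0"] by (simp add: Lp_nzero Lp_nnorm_class antisym)
qed


section \<open>Module maps between \<open>L\<^sub>p\<close> spaces\<close>

text \<open>The acting algebra, written in terms of a measure. It depends only on the underlying
  measurable space (\<open>bounded_borel_cong\<close>).\<close>

definition bounded_borel :: "'a measure \<Rightarrow> ('a \<Rightarrow> complex) set" where
  "bounded_borel M = {b \<in> borel_measurable M. bounded (b ` space M)}"

lemma bounded_borelI:
  assumes "b \<in> borel_measurable M" "\<And>x. norm (b x) \<le> C"
  shows "b \<in> bounded_borel M"
  using assms by (auto simp: bounded_borel_def bounded_iff)

lemma bounded_borel_cong:
  assumes "sets N = sets M"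
  shows "bounded_borel N = bounded_borel M"
  unfolding bounded_borel_def measurable_cong_sets[OF assms refl] sets_eq_imp_space_eq[OF assms] ..

text \<open>The function \<open>g\<close> is a representative of the image of the constant \<open>1\<close>, and \<open>b = b \<cdot> 1\<close>.\<close>

lemma module_map_is_multiplication:
  assumes "finite_measure M" "1 \<le> p" "sets N = sets M"
    and i: "i \<in> module_maps (bounded_borel M) (Lp_of M p) (Lp_of N q)"
  obtains g where "g \<in> borel_measurable N"
    "\<And>b. b \<in> bounded_borel M \<Longrightarrow> i (ae_class M b) = ae_class N (\<lambda>x. b x * g x)"
proof -
  have one: "(\<lambda>_. 1) \<in> Lp_funs M p" by (rule bounded_in_Lp_funs[OF assms(1,2), of _ 1]) auto
  then have pt: "ae_class M (\<lambda>_. 1) \<in> pts (Lp_of M p)" by (simp add: Lp_of_def)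
  then have "i (ae_class M (\<lambda>_. 1)) \<in> pts (Lp_of N q)" using i by (auto simp: module_maps_def)
  then obtain g where g: "g \<in> borel_measurable N" "i (ae_class M (\<lambda>_. 1)) = ae_class N g"
    by (rule Lp_ptsE)
  have "i (ae_class M b) = ae_class N (\<lambda>x. b x * g x)" if b: "b \<in> bounded_borel M" for b
  proof -
    have "i (act (Lp_of M p) b (ae_class M (\<lambda>_. 1))) = act (Lp_of N q) b (ae_class N g)"
      using i b pt g(2) by (auto simp: module_maps_def)
    then show ?thesis using g(1) by (simp add: Lp_act_class)
  qed
  with g(1) show ?thesis by (rule that)
qed

text \<open>A density argument would have to treat \<open>p = \<infinity>\<close> separately and pass to limits in \<open>L\<^sub>q(N)\<close>. Localising
  avoids both: on the set where \<open>\<bar>f\<bar> \<le> n\<close> it is the formula for a bounded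
  function, by linearity over the indicator of that set, and these sets exhaust the space.\<close>

lemma module_map_is_multiplication_unbounded:
  assumes "sets N = sets M"
    and i: "i \<in> module_maps (bounded_borel M) (Lp_of M p) (Lp_of N q)"
    and g: "g \<in> borel_measurable N"
    and ig: "\<And>b. b \<in> bounded_borel M \<Longrightarrow> i (ae_class M b) = ae_class N (\<lambda>x. b x * g x)"
    and f: "f \<in> Lp_funs M p"
  shows "i (ae_class M f) = ae_class N (\<lambda>x. f x * g x)"
proof -
  have meas: "f \<in> borel_measurable N \<longleftrightarrow> f \<in> borel_measurable M" for f :: "'a \<Rightarrow> complex"
    using measurable_cong_sets[OF assms(1) refl] by blast
  have fm[measurable]: "f \<in> borel_measurable M" "g \<in> borel_measurable M"
    using Lp_funs_measurable[OF f] g meas by auto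
  have pt: "ae_class M f \<in> pts (Lp_of M p)" using f by (simp add: Lp_of_def)
  then have "i (ae_class M f) \<in> pts (Lp_of N q)" using i by (auto simp: module_maps_def)
  then obtain h where h: "h \<in> borel_measurable N" "i (ae_class M f) = ae_class N h"
    by (rule Lp_ptsE)
  define e :: "nat \<Rightarrow> 'a \<Rightarrow> complex" where "e n x = (if norm (f x) \<le> real n then 1 else 0)" for n x
  have em[measurable]: "e n \<in> borel_measurable M" for n
    unfolding e_def by measurable
  have e: "e n \<in> bounded_borel M" "(\<lambda>x. e n x * f x) \<in> bounded_borel M" for n
    by (rule bounded_borelI[where C = 1]; simp add: e_def)
       (rule bounded_borelI[where C = "real n"]; simp add: e_def)
  have "AE x in N. e n x * h x = e n x * f x * g x" for n
  proof -
    have "ae_class N (\<lambda>x. e n x * h x) = act (Lp_of N q) (e n) (i (ae_class M f))"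
      using h by (simp add: Lp_act_class)
    also have "\<dots> = i (act (Lp_of M p) (e n) (ae_class M f))"
      using i e(1) pt by (auto simp: module_maps_def)
    also have "\<dots> = ae_class N (\<lambda>x. e n x * f x * g x)"
      using ig[OF e(2)] by (simp add: Lp_act_class)
    finally show ?thesis by (rule ae_class_eqD) (use h(1) meas em in auto)
  qed
  then have "AE x in N. \<forall>n. e n x * h x = e n x * f x * g x"
    unfolding AE_all_countable by blast
  then have "AE x in N. h x = f x * g x"
  proof eventually_elim
    case (elim x)
    have "e (nat \<lceil>norm (f x)\<rceil>) x = 1" by (simp add: e_def)
    then show ?case using spec[OF elim, of "nat \<lceil>norm (f x)\<rceil>"] by simp
  qed
  then show ?thesis using h(2) ae_class_cong by metis
qed

text \<open>The retraction is division by \<open>g = i(1)\<close>. The lower bound for \<open>i\<close> is used three times, always on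
  bounded functions: on indicators of \<open>N\<close>-null sets, to see that they are \<open>M\<close>-null and so that
  division does not depend on the representative; on the indicator of the zero set of \<open>g\<close>, to see that this
  set is \<open>M\<close>-null; and on truncations of \<open>h / g\<close>, to bound their norms uniformly.\<close>

lemma topologically_injective_has_retraction:
  assumes "finite_measure M" "1 \<le> p" "1 \<le> q" "sets N = sets M"
    and i: "i \<in> module_maps (bounded_borel M) (Lp_of M p) (Lp_of N q)"
    and c: "0 < c"
    and below: "\<forall>x\<in>pts (Lp_of M p). c * nnorm (Lp_of M p) x \<le> nnorm (Lp_of N q) (i x)"
  shows "\<exists>j\<in>module_maps (bounded_borel M) (Lp_of N q) (Lp_of M p).
    (\<forall>x\<in>pts (Lp_of M p). j (i x) = x) \<and>
    (\<forall>y\<in>pts (Lp_of N q). nnorm (Lp_of M p) (j y) \<le> nnorm (Lp_of N q) y / c)"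
proof -
  have meas: "f \<in> borel_measurable N \<longleftrightarrow> f \<in> borel_measurable M" for f :: "'a \<Rightarrow> complex"
    using measurable_cong_sets[OF assms(4) refl] by blast
  obtain g where gN: "g \<in> borel_measurable N"
    and ib: "\<And>b. b \<in> bounded_borel M \<Longrightarrow> i (ae_class M b) = ae_class N (\<lambda>x. b x * g x)"
    using module_map_is_multiplication[OF assms(1,2,4) i] by blast
  have g[measurable]: "g \<in> borel_measurable M" using gN meas by simp
  have bL: "b \<in> Lp_funs M p" if "b \<in> bounded_borel M" for b
  proof -
    obtain C where "\<And>x. x \<in> space M \<Longrightarrow> norm (b x) \<le> C"
      using \<open>b \<in> bounded_borel M\<close> by (auto simp: bounded_borel_def bounded_iff)
    moreover have "b \<in> borel_measurable M" using that by (simp add: bounded_borel_def)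
    ultimately show ?thesis by (intro bounded_in_Lp_funs[OF assms(1,2)])
  qed
  have bi: "c * Lp_seminorm M p b \<le> Lp_seminorm N q (\<lambda>x. b x * g x)" if b: "b \<in> bounded_borel M" for b
  proof -
    have "b \<in> borel_measurable M" using b by (simp add: bounded_borel_def)
    moreover from this have "(\<lambda>x. b x * g x) \<in> borel_measurable N" unfolding meas by simp
    ultimately show ?thesis
      using bspec[OF below Lp_ptsI[OF bL[OF b]]] by (simp add: ib[OF b] Lp_nnorm_class)
  qed
  have null: "AE x in M. b x = 0" if b: "b \<in> bounded_borel M" and 0: "AE x in N. b x * g x = 0" for b
  proof (rule Lp_seminorm_eq_0D[OF assms(2) bL[OF b]])
    have "Lp_seminorm N q (\<lambda>x. b x * g x) = Lp_seminorm N q (\<lambda>x. 0)"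
      using 0 b by (intro Lp_seminorm_cong) (auto simp: meas bounded_borel_def)
    also have "\<dots> = 0" using Lp_nnorm_nzero[OF assms(3), of N] by (simp add: Lp_nzero Lp_nnorm_class)
    finally have "c * Lp_seminorm M p b \<le> 0" using bi[OF b] by simp
    then show "Lp_seminorm M p b \<le> 0" using c by (simp add: mult_le_0_iff)
  qed
  have ac: "AE x in M. P x" if "AE x in N. P x" for P
  proof -
    have "null_sets N \<subseteq> null_sets M"
    proof
      fix E assume E: "E \<in> null_sets N"
      then have EM: "E \<in> sets M" using assms(4) by auto
      have "indicator E \<in> bounded_borel M"
        using EM by (intro bounded_borelI[where C = 1]) (auto simp: indicator_def)
      moreover have "AE x in N. indicator E x * g x = 0"
        using AE_not_in[OF E] by eventually_elim simp
      ultimately have "AE x in M. indicator E x = (0::complex)" by (rule null)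
      then have "AE x in M. x \<notin> E" by eventually_elim (simp add: indicator_def split: if_splits)
      then show "E \<in> null_sets M" using EM by (simp add: AE_iff_null_sets)
    qed
    then show ?thesis using that absolutely_continuous_AE[of M N P] assms(4)
      by (simp add: absolutely_continuous_def)
  qed
  have gnz: "AE x in M. g x \<noteq> 0"
  proof -
    have "(\<lambda>x. if g x = 0 then 1 else 0) \<in> bounded_borel M"
      by (intro bounded_borelI[where C = 1]) auto
    then have "AE x in M. (if g x = 0 then 1 else 0 :: complex) = 0" by (rule null) auto
    then show ?thesis by eventually_elim (simp split: if_splits)
  qed
  have quot: "(\<lambda>x. h x / g x) \<in> Lp_funs M p \<and> Lp_seminorm M p (\<lambda>x. h x / g x) \<le> Lp_seminorm N q h / c"
    if h: "h \<in> Lp_funs N q" for h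
  proof -
    have hN: "h \<in> borel_measurable N" and hM[measurable]: "h \<in> borel_measurable M"
      using Lp_funs_measurable[OF h] meas by auto
    define t :: "nat \<Rightarrow> 'a \<Rightarrow> complex" where
      "t n x = (if norm (h x / g x) \<le> real n then h x / g x else 0)" for n x
    have t: "t n \<in> bounded_borel M" for n
    proof (rule bounded_borelI)
      show "t n \<in> borel_measurable M" unfolding t_def by measurable
      show "norm (t n x) \<le> real n" for x by (simp add: t_def)
    qed
    have tN: "t n \<in> borel_measurable N" for n using t by (simp add: meas bounded_borel_def)
    have "Lp_seminorm M p (t n) \<le> Lp_seminorm N q h / c" for n
    proof -
      \<comment> \<open>Where \<open>g\<close> vanishes, both \<open>h / g\<close> and its product with \<open>g\<close> are \<open>0\<close>.\<close>
      have "AE x in N. norm (t n x * g x) \<le> 1 * norm (h x)" by (simp add: t_def)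
      then have "Lp_seminorm N q (\<lambda>x. t n x * g x) \<le> 1 * Lp_seminorm N q h"
        using tN gN by (intro Lp_dominated(2)[OF assms(3) h]) auto
      then show ?thesis using bi[OF t, of n] c by (simp add: field_simps)
    qed
    moreover have "(\<lambda>x. h x / g x) \<in> borel_measurable M" by measurable
    ultimately show ?thesis
      using Lp_truncation_bound[OF assms(2), of "\<lambda>x. h x / g x" M "Lp_seminorm N q h / c"] bL[OF t]
      by (simp add: t_def[abs_def])
  qed
  \<comment> \<open>The union is over equal classes, as for the module operations on \<open>L\<^sub>p\<close>.\<close>
  define j where "j = (\<lambda>y\<in>pts (Lp_of N q). \<Union>h\<in>y. ae_class M (\<lambda>x. h x / g x))"
  have j: "j (ae_class N h) = ae_class M (\<lambda>x. h x / g x)" if h: "h \<in> Lp_funs N q" for h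
  proof -
    have "ae_class M (\<lambda>x. k x / g x) = ae_class M (\<lambda>x. h x / g x)" if "k \<in> ae_class N h" for k
    proof (rule ae_class_cong)
      have "AE x in N. k x = h x" using that by (simp add: ae_class_def)
      then have "AE x in M. k x = h x" by (rule ac)
      then show "AE x in M. k x / g x = h x / g x" by eventually_elim simp
    qed
    then have "(\<Union>k\<in>ae_class N h. ae_class M (\<lambda>x. k x / g x)) = ae_class M (\<lambda>x. h x / g x)"
      using ae_class_self[OF Lp_funs_measurable[OF h]] by blast
    moreover have "ae_class N h \<in> pts (Lp_of N q)" using h by (simp add: Lp_of_def)
    ultimately show ?thesis by (simp add: j_def)
  qed
  have qm: "(\<lambda>x. h x / g x) \<in> borel_measurable M" if "h \<in> borel_measurable N" for h
    using that by (simp add: meas)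
  show ?thesis
  proof (intro bexI[of _ j] conjI ballI)
    show norm_j: "nnorm (Lp_of M p) (j y) \<le> nnorm (Lp_of N q) y / c" if "y \<in> pts (Lp_of N q)" for y
      using that
    proof (rule Lp_ptsE)
      fix h assume h: "h \<in> Lp_funs N q" "h \<in> borel_measurable N" "y = ae_class N h"
      then show ?thesis using quot[OF h(1)] qm[OF h(2)] by (simp add: j Lp_nnorm_class)
    qed
    show "j (i x) = x" if "x \<in> pts (Lp_of M p)" for x
      using that
    proof (rule Lp_ptsE)
      fix f assume f: "f \<in> Lp_funs M p" "f \<in> borel_measurable M" "x = ae_class M f"
      have fg: "(\<lambda>x. f x * g x) \<in> borel_measurable N" using f(2) gN by (simp add: meas)
      have ix: "i x = ae_class N (\<lambda>x. f x * g x)"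
        unfolding f(3) by (rule module_map_is_multiplication_unbounded[OF assms(4) i gN ib f(1)])
      moreover have "i x \<in> pts (Lp_of N q)" using i that by (auto simp: module_maps_def)
      ultimately have "(\<lambda>x. f x * g x) \<in> Lp_funs N q" using Lp_pts_iff[OF assms(3) fg] by simp
      then have "j (i x) = ae_class M (\<lambda>x. f x * g x / g x)" unfolding ix by (rule j)
      also have "\<dots> = x" unfolding f(3) using gnz by (intro ae_class_cong) auto
      finally show ?thesis .
    qed
    show "j \<in> module_maps (bounded_borel M) (Lp_of N q) (Lp_of M p)"
      unfolding module_maps_def
    proof (intro CollectI conjI ballI allI)
      show "j \<in> pts (Lp_of N q) \<rightarrow>\<^sub>E pts (Lp_of M p)"
      proof (rule PiE_I)
        fix y assume "y \<in> pts (Lp_of N q)"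
        then show "j y \<in> pts (Lp_of M p)"
        proof (rule Lp_ptsE)
          fix h assume h: "h \<in> Lp_funs N q" "h \<in> borel_measurable N" "y = ae_class N h"
          then show ?thesis using quot[OF h(1)] qm[OF h(2)] by (simp add: j Lp_pts_iff[OF assms(2)])
        qed
      qed (simp add: j_def)
    next
      fix y z assume "y \<in> pts (Lp_of N q)" "z \<in> pts (Lp_of N q)"
      then show "j (nadd (Lp_of N q) y z) = nadd (Lp_of M p) (j y) (j z)"
        by (elim Lp_ptsE)
          (simp add: Lp_nadd_class j Lp_funs_add[OF assms(3)] qm add_divide_distrib)
    next
      fix d y assume y: "y \<in> pts (Lp_of N q)"
      then show "j (nscale (Lp_of N q) d y) = nscale (Lp_of M p) d (j y)"
      proof (rule Lp_ptsE)
        fix h assume h: "h \<in> Lp_funs N q" "h \<in> borel_measurable N" "y = ae_class N h"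
        have "(\<lambda>x. d * h x) \<in> Lp_funs N q"
          using Lp_nscale_pts[OF assms(3) y, of d] h by (simp add: Lp_nscale_class Lp_pts_iff[OF assms(3)])
        then show ?thesis using h by (simp add: Lp_nscale_class j qm)
      qed
    next
      fix b y assume b: "b \<in> bounded_borel M" and y: "y \<in> pts (Lp_of N q)"
      have bN: "b \<in> borel_measurable N" "bounded (b ` space N)"
        using b meas sets_eq_imp_space_eq[OF assms(4)] by (auto simp: bounded_borel_def)
      from y show "j (act (Lp_of N q) b y) = act (Lp_of M p) b (j y)"
      proof (rule Lp_ptsE)
        fix h assume h: "h \<in> Lp_funs N q" "h \<in> borel_measurable N" "y = ae_class N h"
        have "(\<lambda>x. b x * h x) \<in> Lp_funs N q"
          using Lp_act_pts[OF assms(3) y bN] h bN by (simp add: Lp_act_class Lp_pts_iff[OF assms(3)])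
        then show ?thesis using h by (simp add: Lp_act_class j qm)
      qed
    next
      show "bounded_map (Lp_of N q) (Lp_of M p) j"
        unfolding bounded_map_def using norm_j by (intro exI[of _ "1 / c"]) auto
    qed
  qed
qed


section \<open>Precomposition on spaces of module maps\<close>

text \<open>The operator norm is a supremum of reals, hence an upper bound only for bounded maps.\<close>

lemma op_norm_bdd_above:
  assumes "bounded_map X Y T" "\<And>x. x \<in> pts X \<Longrightarrow> 0 \<le> nnorm X x"
  shows "bdd_above ((\<lambda>x. nnorm Y (T x)) ` {x \<in> pts X. nnorm X x \<le> 1})"
proof -
  obtain C where C: "\<And>x. x \<in> pts X \<Longrightarrow> nnorm Y (T x) \<le> C * nnorm X x"
    using assms(1) by (auto simp: bounded_map_def)
  show ?thesis
  proof (rule bdd_aboveI2)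
    fix x assume "x \<in> {x \<in> pts X. nnorm X x \<le> 1}"
    then have x: "x \<in> pts X" "nnorm X x \<le> 1" by auto
    have "nnorm Y (T x) \<le> \<bar>C\<bar> * nnorm X x"
      using C[OF x(1)] assms(2)[OF x(1)] mult_right_mono[of C "\<bar>C\<bar>"] by force
    also have "\<dots> \<le> \<bar>C\<bar>" using x(2) by (simp add: mult_left_le)
    finally show "nnorm Y (T x) \<le> \<bar>C\<bar>" .
  qed
qed

lemma op_norm_upper:
  assumes "bounded_map X Y T" "\<And>x. x \<in> pts X \<Longrightarrow> 0 \<le> nnorm X x" "x \<in> pts X" "nnorm X x \<le> 1"
  shows "nnorm Y (T x) \<le> op_norm X Y T"
  unfolding op_norm_def using op_norm_bdd_above[OF assms(1,2)] assms(3,4) by (intro cSUP_upper) auto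

text \<open>A map into \<open>Y\<close> that preserves the unit ball does not increase operator norms under precomposition. This
  serves twice: for \<open>Hom(i, I)\<close> itself and for the extension along the retraction. The point \<open>x0\<close> keeps the
  supremum from being over the empty set.\<close>

lemma op_norm_compose_le:
  assumes "bounded_map Y Z T" "\<And>y. y \<in> pts Y \<Longrightarrow> 0 \<le> nnorm Y y" "j \<in> pts X \<rightarrow> pts Y"
    and "\<And>x. x \<in> pts X \<Longrightarrow> nnorm X x \<le> 1 \<Longrightarrow> nnorm Y (j x) \<le> 1"
    and "x0 \<in> pts X" "nnorm X x0 \<le> 1"
  shows "op_norm X Z (compose (pts X) T j) \<le> op_norm Y Z T"
proof -
  have "nnorm Z (compose (pts X) T j x) \<le> op_norm Y Z T" if "x \<in> pts X" "nnorm X x \<le> 1" for x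
  proof -
    have "j x \<in> pts Y" using assms(3) that(1) by (rule Pi_mem)
    then have "nnorm Z (T (j x)) \<le> op_norm Y Z T"
      using op_norm_upper[OF assms(1,2)] assms(4)[OF that] by blast
    then show ?thesis using that(1) by (simp add: compose_eq)
  qed
  then show ?thesis
    unfolding op_norm_def[of X] using assms(5,6) by (intro cSUP_least) auto
qed

lemma compose_module_maps:
  assumes "1 \<le> p" and j: "j \<in> module_maps (bounded_borel M) (Lp_of M p) Y"
    and T: "T \<in> module_maps (bounded_borel M) Y Z"
    and Y: "\<And>y. y \<in> pts Y \<Longrightarrow> 0 \<le> nnorm Y y"
  shows "compose (pts (Lp_of M p)) T j \<in> module_maps (bounded_borel M) (Lp_of M p) Z"
proof -
  let ?X = "Lp_of M p"
  have jp: "j x \<in> pts Y" if "x \<in> pts ?X" for x using j that by (auto simp: module_maps_def)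
  have "bounded_map ?X Y j" "bounded_map Y Z T" using j T by (simp_all add: module_maps_def)
  then obtain C D where CD: "\<And>x. x \<in> pts ?X \<Longrightarrow> nnorm Y (j x) \<le> D * nnorm ?X x"
    "\<And>y. y \<in> pts Y \<Longrightarrow> nnorm Z (T y) \<le> C * nnorm Y y"
    unfolding bounded_map_def by blast
  have "nnorm Z (T (j x)) \<le> (\<bar>C\<bar> * D) * nnorm ?X x" if x: "x \<in> pts ?X" for x
  proof -
    have "nnorm Z (T (j x)) \<le> C * nnorm Y (j x)" by (rule CD(2)[OF jp[OF x]])
    also have "\<dots> \<le> \<bar>C\<bar> * nnorm Y (j x)" using Y[OF jp[OF x]] by (intro mult_right_mono) auto
    also have "\<dots> \<le> \<bar>C\<bar> * (D * nnorm ?X x)" using CD(1)[OF x] by (intro mult_left_mono) auto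
    finally show ?thesis by (simp add: mult.assoc)
  qed
  then have "bounded_map ?X Z (compose (pts ?X) T j)"
    unfolding bounded_map_def by (intro exI[of _ "\<bar>C\<bar> * D"]) (simp add: compose_eq)
  moreover have "compose (pts ?X) T j \<in> pts ?X \<rightarrow>\<^sub>E pts Z"
    using T jp by (auto simp: compose_def module_maps_def)
  moreover have "nadd ?X x y \<in> pts ?X" "nscale ?X c x \<in> pts ?X" if "x \<in> pts ?X" "y \<in> pts ?X" for x y c
    using Lp_nadd_pts[OF assms(1) that] Lp_nscale_pts[OF assms(1) that(1)] by blast+
  moreover have "act ?X b x \<in> pts ?X" if "x \<in> pts ?X" "b \<in> bounded_borel M" for x b
    using Lp_act_pts[OF assms(1) that(1)] that(2) by (simp add: bounded_borel_def)
  ultimately show ?thesis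
    using j T jp unfolding module_maps_def by (simp add: compose_eq)
qed

lemma zero_module_map:
  assumes "1 \<le> p" "1 \<le> r"
  shows "(\<lambda>x\<in>pts (Lp_of M p). nzero (Lp_of K r)) \<in> module_maps (bounded_borel M) (Lp_of M p) (Lp_of K r)"
proof -
  have "bounded_map (Lp_of M p) (Lp_of K r) (\<lambda>x\<in>pts (Lp_of M p). nzero (Lp_of K r))"
    unfolding bounded_map_def by (intro exI[of _ 0]) (simp add: Lp_nnorm_nzero[OF assms(2)])
  moreover have "nadd (Lp_of K r) (nzero (Lp_of K r)) (nzero (Lp_of K r)) = nzero (Lp_of K r)"
    "nscale (Lp_of K r) c (nzero (Lp_of K r)) = nzero (Lp_of K r)"
    "act (Lp_of K r) b (nzero (Lp_of K r)) = nzero (Lp_of K r)" for c b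
    by (simp_all add: Lp_nzero Lp_nadd_class Lp_nscale_class Lp_act_class)
  moreover have "act (Lp_of M p) b x \<in> pts (Lp_of M p)"
    if "x \<in> pts (Lp_of M p)" "b \<in> bounded_borel M" for x b
    using Lp_act_pts[OF assms(1) that(1)] that(2) by (simp add: bounded_borel_def)
  ultimately show ?thesis
    unfolding module_maps_def
    by (simp add: Lp_nadd_pts[OF assms(1)] Lp_nscale_pts[OF assms(1)] Lp_nzero_pts[OF assms(2)])
qed

lemma op_norm_zero:
  assumes "1 \<le> p" "1 \<le> r"
  shows "op_norm (Lp_of M p) (Lp_of K r) (\<lambda>x\<in>pts (Lp_of M p). nzero (Lp_of K r)) = 0"
proof -
  have "nzero (Lp_of M p) \<in> {x \<in> pts (Lp_of M p). nnorm (Lp_of M p) x \<le> 1}"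
    using assms by (simp add: Lp_nzero_pts Lp_nnorm_nzero)
  then have "(\<lambda>x. nnorm (Lp_of K r) ((\<lambda>x\<in>pts (Lp_of M p). nzero (Lp_of K r)) x))
      ` {x \<in> pts (Lp_of M p). nnorm (Lp_of M p) x \<le> 1} = {0}"
    by (auto simp: Lp_nnorm_nzero[OF assms(2)] image_iff)
  then show ?thesis unfolding op_norm_def by simp
qed

text \<open>A map that vanishes in norm on the unit ball vanishes everywhere, by rescaling. This is needed
  for coisometry, where the zero map has to lift to the zero map.\<close>

lemma op_norm_eq_0D:
  assumes "1 \<le> p" "1 \<le> r" and T: "T \<in> module_maps (bounded_borel M) (Lp_of M p) (Lp_of K r)"
    and 0: "op_norm (Lp_of M p) (Lp_of K r) T \<le> 0"
  shows "T = (\<lambda>x\<in>pts (Lp_of M p). nzero (Lp_of K r))"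
proof (rule extensionalityI[of _ "pts (Lp_of M p)"])
  let ?X = "Lp_of M p" and ?Z = "Lp_of K r"
  show "T \<in> extensional (pts ?X)" using T by (auto simp: module_maps_def PiE_def)
  fix x assume x: "x \<in> pts ?X"
  \<comment> \<open>Dividing by \<open>1 + \<parallel>x\<parallel>\<close> brings \<open>x\<close> into the unit ball even if \<open>\<parallel>x\<parallel> = 0\<close>.\<close>
  define d where "d = complex_of_real (1 / (1 + nnorm ?X x))"
  have nx: "0 \<le> nnorm ?X x" by (rule Lp_nnorm_nonneg[OF x])
  have d: "d \<noteq> 0" "norm d * nnorm ?X x \<le> 1"
    using nx by (simp_all add: d_def norm_divide del: of_real_add of_real_divide)
  have dx: "nscale ?X d x \<in> pts ?X" by (rule Lp_nscale_pts[OF assms(1) x])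
  have Tx: "T x \<in> pts ?Z" using T x by (auto simp: module_maps_def)
  have Tdx: "T (nscale ?X d x) = nscale ?Z d (T x)" using T x by (auto simp: module_maps_def)
  have "bounded_map ?X ?Z T" using T by (simp add: module_maps_def)
  then have "nnorm ?Z (T (nscale ?X d x)) \<le> op_norm ?X ?Z T"
    by (rule op_norm_upper)
      (use dx Lp_nnorm_nonneg Lp_nscale_norm_le[OF assms(1) x, of d] d(2) in auto)
  then have "nnorm ?Z (nscale ?Z d (T x)) \<le> 0" using 0 Tdx by simp
  moreover have "nnorm ?Z (T x) \<le> norm (1 / d) * nnorm ?Z (nscale ?Z d (T x))"
    using Lp_nscale_norm_le[OF assms(2) Lp_nscale_pts[OF assms(2) Tx, of d], of "1 / d"] d(1)
    by (simp add: Lp_nscale_nscale[OF Tx])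
  ultimately have "nnorm ?Z (T x) \<le> 0"
    by (meson mult_nonneg_nonpos norm_ge_zero order_trans)
  then have "T x = nzero ?Z" by (rule Lp_nnorm_eq_0D[OF assms(2) Tx])
  then show "T x = (\<lambda>x\<in>pts ?X. nzero ?Z) x" using x by simp
qed auto

lemma Hom_pre_contractive:
  assumes "1 \<le> p" "1 \<le> q" "1 \<le> r" "bounded_borel N = bounded_borel M"
    and i: "i \<in> module_maps (bounded_borel M) (Lp_of M p) (Lp_of N q)"
    and ci: "contractive (Lp_of M p) (Lp_of N q) i"
  shows "contractive (Hom (bounded_borel M) (Lp_of N q) (Lp_of K r))
    (Hom (bounded_borel M) (Lp_of M p) (Lp_of K r)) (Hom_pre (Lp_of M p) i)"
proof -
  let ?X = "Lp_of M p" and ?Y = "Lp_of N q" and ?Z = "Lp_of K r"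
  have unit: "nnorm ?Y (i x) \<le> 1" if "x \<in> pts ?X" "nnorm ?X x \<le> 1" for x
    using op_norm_upper[of ?X ?Y i x] ci that Lp_nnorm_nonneg by (fastforce simp: contractive_def)
  have le: "op_norm ?X ?Z (Hom_pre ?X i T) \<le> op_norm ?Y ?Z T"
    if "T \<in> module_maps (bounded_borel M) ?Y ?Z" for T
    unfolding Hom_pre_def
  proof (rule op_norm_compose_le[OF _ Lp_nnorm_nonneg _ unit])
    show "bounded_map ?Y ?Z T" using that by (simp add: module_maps_def)
    show "i \<in> pts ?X \<rightarrow> pts ?Y" using i by (auto simp: module_maps_def)
    show "nzero ?X \<in> pts ?X" by (rule Lp_nzero_pts[OF assms(1)])
    show "nnorm ?X (nzero ?X) \<le> 1" by (simp add: Lp_nnorm_nzero[OF assms(1)])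
  qed
  have "(\<lambda>x\<in>pts ?Y. nzero ?Z) \<in> {T \<in> module_maps (bounded_borel M) ?Y ?Z. op_norm ?Y ?Z T \<le> 1}"
    using zero_module_map[OF assms(2,3), where M = N and K = K] op_norm_zero[OF assms(2,3), of N K] assms(4) by simp
  then have "{T \<in> module_maps (bounded_borel M) ?Y ?Z. op_norm ?Y ?Z T \<le> 1} \<noteq> {}" by blast
  moreover have "op_norm ?X ?Z (Hom_pre ?X i T) \<le> 1"
    if "T \<in> module_maps (bounded_borel M) ?Y ?Z" "op_norm ?Y ?Z T \<le> 1" for T
    using le[OF that(1)] that(2) by simp
  ultimately have "op_norm (Hom (bounded_borel M) ?Y ?Z) (Hom (bounded_borel M) ?X ?Z) (Hom_pre ?X i) \<le> 1"
    unfolding op_norm_def[of "Hom (bounded_borel M) ?Y ?Z"] by (intro cSUP_least) (auto simp: Hom_def)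
  moreover have "bounded_map (Hom (bounded_borel M) ?Y ?Z) (Hom (bounded_borel M) ?X ?Z) (Hom_pre ?X i)"
    unfolding bounded_map_def Hom_def using le by (intro exI[of _ 1]) auto
  ultimately show ?thesis by (simp add: contractive_def)
qed

lemma extension_along_retract:
  assumes "1 \<le> q" "bounded_borel N = bounded_borel M"
    and i: "i \<in> module_maps (bounded_borel M) (Lp_of M p) (Lp_of N q)"
    and j: "j \<in> module_maps (bounded_borel M) (Lp_of N q) (Lp_of M p)"
    and ji: "\<And>x. x \<in> pts (Lp_of M p) \<Longrightarrow> j (i x) = x"
    and T: "T \<in> module_maps (bounded_borel M) (Lp_of M p) Z"
  shows "compose (pts (Lp_of N q)) T j \<in> module_maps (bounded_borel M) (Lp_of N q) Z"
    "Hom_pre (Lp_of M p) i (compose (pts (Lp_of N q)) T j) = T"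
proof -
  show "compose (pts (Lp_of N q)) T j \<in> module_maps (bounded_borel M) (Lp_of N q) Z"
    using compose_module_maps[OF assms(1), of j N "Lp_of M p" T Z] j T assms(2) Lp_nnorm_nonneg by auto
  show "Hom_pre (Lp_of M p) i (compose (pts (Lp_of N q)) T j) = T"
    unfolding Hom_pre_def
  proof (rule extensionalityI[of _ "pts (Lp_of M p)"])
    show "T \<in> extensional (pts (Lp_of M p))" using T by (auto simp: module_maps_def PiE_def)
    fix x assume x: "x \<in> pts (Lp_of M p)"
    then have "i x \<in> pts (Lp_of N q)" using i by (auto simp: module_maps_def)
    then show "compose (pts (Lp_of M p)) (compose (pts (Lp_of N q)) T j) i x = T x"
      using x by (simp add: compose_eq ji)
  qed (rule compose_extensional)
qed

lemma Hom_pre_surjective: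
  assumes "finite_measure M" "1 \<le> p" "1 \<le> q" "sets N = sets M"
    and i: "i \<in> module_maps (bounded_borel M) (Lp_of M p) (Lp_of N q)"
    and "topologically_injective (Lp_of M p) (Lp_of N q) i"
  shows "surjective (Hom (bounded_borel M) (Lp_of N q) Z) (Hom (bounded_borel M) (Lp_of M p) Z)
    (Hom_pre (Lp_of M p) i)"
proof -
  obtain c where c: "0 < c" "\<forall>x\<in>pts (Lp_of M p). c * nnorm (Lp_of M p) x \<le> nnorm (Lp_of N q) (i x)"
    using assms(6) by (auto simp: topologically_injective_def)
  obtain j where j: "j \<in> module_maps (bounded_borel M) (Lp_of N q) (Lp_of M p)"
    "\<And>x. x \<in> pts (Lp_of M p) \<Longrightarrow> j (i x) = x"
    using topologically_injective_has_retraction[OF assms(1-5) c] by blast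
  show ?thesis
    using extension_along_retract[OF assms(3) bounded_borel_cong[OF assms(4)] i j]
    unfolding surjective_def Hom_def by force
qed

lemma Hom_pre_strictly_coisometric:
  assumes "finite_measure M" "1 \<le> p" "1 \<le> q" "1 \<le> r" "sets N = sets M"
    and i: "i \<in> module_maps (bounded_borel M) (Lp_of M p) (Lp_of N q)"
    and "contractive (Lp_of M p) (Lp_of N q) i" "isometric (Lp_of M p) (Lp_of N q) i"
  shows "strictly_coisometric (Hom (bounded_borel M) (Lp_of N q) (Lp_of K r))
    (Hom (bounded_borel M) (Lp_of M p) (Lp_of K r)) (Hom_pre (Lp_of M p) i)"
proof -
  let ?X = "Lp_of M p" and ?Y = "Lp_of N q" and ?Z = "Lp_of K r"
  note BB = bounded_borel_cong[OF assms(5)]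
  have iso: "\<forall>x\<in>pts ?X. 1 * nnorm ?X x \<le> nnorm ?Y (i x)"
    using assms(8) by (simp add: isometric_def)
  obtain j where j1: "j \<in> module_maps (bounded_borel M) ?Y ?X"
    and ji: "\<forall>x\<in>pts ?X. j (i x) = x"
    and nj: "\<forall>y\<in>pts ?Y. nnorm ?X (j y) \<le> nnorm ?Y y / 1"
    using topologically_injective_has_retraction[OF assms(1-3,5) i zero_less_one iso]
    by (elim bexE conjE) (rule that)
  note j = j1 bspec[OF ji]
  have "op_norm ?Y ?Z (compose (pts ?Y) T j) \<le> op_norm ?X ?Z T"
    if "T \<in> module_maps (bounded_borel M) ?X ?Z" for T
  proof (rule op_norm_compose_le[OF _ Lp_nnorm_nonneg])
    show "bounded_map ?X ?Z T" using that by (simp add: module_maps_def)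
    show "j \<in> pts ?Y \<rightarrow> pts ?X" using j by (auto simp: module_maps_def)
    show "nnorm ?X (j y) \<le> 1" if "y \<in> pts ?Y" "nnorm ?Y y \<le> 1" for y
      using bspec[OF nj that(1)] that(2) by simp
    show "nzero ?Y \<in> pts ?Y" by (rule Lp_nzero_pts[OF assms(3)])
    show "nnorm ?Y (nzero ?Y) \<le> 1" by (simp add: Lp_nnorm_nzero[OF assms(3)])
  qed
  then show ?thesis
    unfolding strictly_coisometric_def
    using Hom_pre_contractive[OF assms(2-4) BB i assms(7)] extension_along_retract[OF assms(3) BB i j]
    by (simp add: Hom_def) blast
qed

text \<open>For \<open>y \<noteq> 0\<close> the strict inequality follows from \<open>0 < \<parallel>y\<parallel>\<close>. For \<open>y = 0\<close> the preimage of norm at most \<open>0\<close>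
  is zero, as demanded.\<close>

lemma strictly_coisometric_imp_coisometric:
  assumes "strictly_coisometric X Y T"
    and X: "\<And>x. x \<in> pts X \<Longrightarrow> nnorm X x \<le> 0 \<Longrightarrow> x = nzero X"
    and Y: "\<And>y. y \<in> pts Y \<Longrightarrow> nnorm Y y \<le> 0 \<Longrightarrow> y = nzero Y" "nnorm Y (nzero Y) = 0"
  shows "coisometric X Y T"
  unfolding coisometric_def
proof (intro conjI allI impI ballI)
  show "contractive X Y T" using assms(1) by (simp add: strictly_coisometric_def)
  fix c :: real and y assume c: "1 < c" and y: "y \<in> pts Y"
  obtain x where x: "x \<in> pts X" "T x = y" "nnorm X x \<le> nnorm Y y"
    using assms(1) y by (auto simp: strictly_coisometric_def)
  have "if y = nzero Y then x = nzero X else nnorm X x < c * nnorm Y y"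
  proof (cases "y = nzero Y")
    case True
    then show ?thesis using X[OF x(1)] x(3) Y(2) by simp
  next
    case False
    then have "0 < nnorm Y y" using Y(1)[OF y] by linarith
    then have "nnorm Y y < c * nnorm Y y" using c by simp
    then show ?thesis using x(3) False by simp
  qed
  then show "\<exists>x\<in>pts X. T x = y \<and> (if y = nzero Y then x = nzero X else nnorm X x < c * nnorm Y y)"
    using x by blast
qed

theorem theorem3p2p2:
  fixes \<Omega> :: "'a set" and \<A> :: "'a set set" and \<mu> :: "'a set \<Rightarrow> complex" and p :: ennreal
  assumes "sigma_algebra \<Omega> \<A>"
    and "complex_measure \<A> \<mu>"
    and "1 \<le> p"
  shows "relatively_injective \<Omega> \<A> (Lp \<Omega> \<A> \<mu> p) \<and>
    metrically_injective \<Omega> \<A> (Lp \<Omega> \<A> \<mu> p) \<and>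
    extremely_injective \<Omega> \<A> (Lp \<Omega> \<A> \<mu> p)"
proof -
  let ?V = "variation_measure \<Omega> \<A>" and ?I = "Lp \<Omega> \<A> \<mu> p"
  have I: "?I \<in> L_obj \<Omega> \<A>" using assms(2,3) by (auto simp: L_obj_def)
  have V: "finite_measure (?V \<nu>)" "sets (?V \<nu>) = \<A>" "bounded_measurable \<Omega> \<A> = bounded_borel (?V \<nu>)"
    if "complex_measure \<A> \<nu>" for \<nu>
  proof -
    interpret sigma_algebra \<Omega> \<A> by fact
    show "finite_measure (?V \<nu>)" by (rule finite_measure_variation[OF assms(1) that])
    show s: "sets (?V \<nu>) = \<A>" by (rule sets_variation_measure[OF assms(1)])
    have "sets (sigma \<Omega> \<A>) = sets (?V \<nu>)" using s by simp
    from measurable_cong_sets[OF this refl]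
    have "borel_measurable (sigma \<Omega> \<A>) = (borel_measurable (?V \<nu>) :: ('a \<Rightarrow> complex) set)" .
    then show "bounded_measurable \<Omega> \<A> = bounded_borel (?V \<nu>)"
      by (simp add: bounded_measurable_def bounded_borel_def space_variation_measure[OF assms(1)])
  qed
  have obj: thesis if "X \<in> L_obj \<Omega> \<A>"
    "\<And>\<nu> s. complex_measure \<A> \<nu> \<Longrightarrow> 1 \<le> s \<Longrightarrow> X = Lp_of (?V \<nu>) s \<Longrightarrow> thesis" for X thesis
    using that unfolding L_obj_def Lp_def by blast
  have rel: "surjective (L_Hom \<Omega> \<A> Y ?I) (L_Hom \<Omega> \<A> X ?I) (Hom_pre X i)"
    if XY: "X \<in> L_obj \<Omega> \<A>" "Y \<in> L_obj \<Omega> \<A>"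
      and i: "i \<in> L_mor \<Omega> \<A> X Y" "topologically_injective X Y i" for X Y i
  proof (rule obj[OF XY(1)], rule obj[OF XY(2)])
    fix \<nu> s \<nu>' s'
    assume X: "complex_measure \<A> \<nu>" "1 \<le> s" "X = Lp_of (?V \<nu>) s"
      and Y: "complex_measure \<A> \<nu>'" "1 \<le> s'" "Y = Lp_of (?V \<nu>') s'"
    have "sets (?V \<nu>') = sets (?V \<nu>)" using V(2)[OF X(1)] V(2)[OF Y(1)] by simp
    then show ?thesis
      using Hom_pre_surjective[OF V(1)[OF X(1)] X(2) Y(2)] i
      by (simp add: X(3) Y(3) L_mor_def V(3)[OF X(1)])
  qed
  have met: "strictly_coisometric (L_Hom \<Omega> \<A> Y ?I) (L_Hom \<Omega> \<A> X ?I) (Hom_pre X i)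
      \<and> coisometric (L_Hom \<Omega> \<A> Y ?I) (L_Hom \<Omega> \<A> X ?I) (Hom_pre X i)"
    if XY: "X \<in> L_obj \<Omega> \<A>" "Y \<in> L_obj \<Omega> \<A>"
      and i: "i \<in> L1_mor \<Omega> \<A> X Y" "isometric X Y i" for X Y i
  proof (rule obj[OF XY(1)], rule obj[OF XY(2)])
    fix \<nu> s \<nu>' s'
    assume X: "complex_measure \<A> \<nu>" "1 \<le> s" "X = Lp_of (?V \<nu>) s"
      and Y: "complex_measure \<A> \<nu>'" "1 \<le> s'" "Y = Lp_of (?V \<nu>') s'"
    have "sets (?V \<nu>') = sets (?V \<nu>)" using V(2)[OF X(1)] V(2)[OF Y(1)] by simp
    then have sc: "strictly_coisometric (L_Hom \<Omega> \<A> Y ?I) (L_Hom \<Omega> \<A> X ?I) (Hom_pre X i)"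
      using Hom_pre_strictly_coisometric[OF V(1)[OF X(1)] X(2) Y(2) assms(3)] i
      by (simp add: X(3) Y(3) L1_mor_def L_mor_def V(3)[OF X(1)] Lp_def)
    moreover have "coisometric (L_Hom \<Omega> \<A> Y ?I) (L_Hom \<Omega> \<A> X ?I) (Hom_pre X i)"
    proof (rule strictly_coisometric_imp_coisometric[OF sc])
      show "T = nzero (L_Hom \<Omega> \<A> Y ?I)"
        if "T \<in> pts (L_Hom \<Omega> \<A> Y ?I)" "nnorm (L_Hom \<Omega> \<A> Y ?I) T \<le> 0" for T
        using op_norm_eq_0D[OF Y(2) assms(3)] that
        by (simp add: Hom_def Y(3) Lp_def V(3)[OF Y(1)])
      show "T = nzero (L_Hom \<Omega> \<A> X ?I)"
        if "T \<in> pts (L_Hom \<Omega> \<A> X ?I)" "nnorm (L_Hom \<Omega> \<A> X ?I) T \<le> 0" for T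
        using op_norm_eq_0D[OF X(2) assms(3)] that
        by (simp add: Hom_def X(3) Lp_def V(3)[OF X(1)])
      show "nnorm (L_Hom \<Omega> \<A> X ?I) (nzero (L_Hom \<Omega> \<A> X ?I)) = 0"
        using op_norm_zero[OF X(2) assms(3)] by (simp add: Hom_def X(3) Lp_def)
    qed
    ultimately show ?thesis by blast
  qed
  show ?thesis
    unfolding relatively_injective_def metrically_injective_def extremely_injective_def
    using I rel met by blast
qed

end
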